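(* Let $E$ be a uniformly convex Banach space, $(\Omega,\mu)$ a Radon measure space, $1\le p,q<\infty$, and let $I\colon L^p(\Omega,E)\to L^\infty(\Omega,E)$ be a continuous linear map. Let $f\colon\Omega\times E\to E$ be a weak Carathéodory map satisfying $$\|f(x,u)\|_E\le A(x)\,\psi(\|u\|_E),$$ where $A\in L^q(\Omega)$ and $\psi\colon[0,\infty)\to[0,\infty)$ is locally bounded. If either $q>1$ or $p=q=1$, then the map $\Psi:=N_f\circ I\colon L^p(\Omega,E)\to L^q(\Omega,E)$ is sequentially weakly continuous.
   Context: $N_f$ is the substitution operator $N_f(w)(x)=f(x,w(x))$. A map $f\colon\Omega\times E\to E$ is a weak Carathéodory map if for each fixed $u\in E$ the map $x\mapsto f(x,u)$ is measurable and for almost every $x\in\Omega$ the map $u\mapsto f(x,u)$ is sequentially weakly continuous. A map $\Psi$ is sequentially weakly continuous if $u_n\rightharpoonup u$ implies $\Psi(u_n)\rightharpoonup\Psi(u)$. *)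

theory Defs
  imports "HOL-Analysis.Analysis"
begin

definition uniformly_convex :: "'e::real_normed_vector itself \<Rightarrow> bool" where
  "uniformly_convex _ \<longleftrightarrow>
     (\<forall>\<epsilon>. 0 < \<epsilon> \<and> \<epsilon> \<le> 2 \<longrightarrow>
       (\<exists>\<delta>>0. \<forall>x y :: 'e. norm x = 1 \<and> norm y = 1 \<and> norm (x - y) \<ge> \<epsilon> \<longrightarrow>
          norm ((1/2) *\<^sub>R (x + y)) \<le> 1 - \<delta>))"

definition radon_measure :: "'a::t2_space measure \<Rightarrow> bool" where
  "radon_measure M \<longleftrightarrow>
     sets M = sets borel \<and>
     (\<forall>x. \<exists>U. open U \<and> x \<in> U \<and> emeasure M U < \<infinity>) \<and>
     (\<forall>B\<in>sets M. emeasure M B = (SUP K\<in>{K. compact K \<and> K \<subseteq> B}. emeasure M K))"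


text \<open>Bochner (strong) measurability. Unlike \<^const>\<open>borel_measurable\<close> on its own, this
  forces the range to be separable up to a null set, and it is invariant under changes on null
  sets even if \<open>M\<close> is not complete.\<close>

definition strongly_measurable :: "'a measure \<Rightarrow> ('a \<Rightarrow> 'e::real_normed_vector) \<Rightarrow> bool" where
  "strongly_measurable M w \<longleftrightarrow>
     (\<exists>s. (\<forall>n::nat. simple_function M (s n)) \<and> (AE x in M. (\<lambda>n. s n x) \<longlonglongrightarrow> w x))"


text \<open>The Lebesgue--Bochner spaces are represented by spaces of functions with a seminorm. The
  elements of the usual spaces are the classes modulo equality almost everywhere, i.e. modulo the
  null space of the seminorm; operators between them are represented by maps that respect these
  classes (\<open>class_map\<close> below), and identities between elements are identities almost everywhere.\<close>

definition Lp :: "'a measure \<Rightarrow> real \<Rightarrow> ('a \<Rightarrow> 'e::real_normed_vector) set" where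
  "Lp M p = {w. strongly_measurable M w \<and> (\<integral>\<^sup>+x. ennreal (norm (w x) powr p) \<partial>M) < \<infinity>}"

definition Lp_norm :: "'a measure \<Rightarrow> real \<Rightarrow> ('a \<Rightarrow> 'e::real_normed_vector) \<Rightarrow> real" where
  "Lp_norm M p w = enn2real (\<integral>\<^sup>+x. ennreal (norm (w x) powr p) \<partial>M) powr (1 / p)"

definition Linf :: "'a measure \<Rightarrow> ('a \<Rightarrow> 'e::real_normed_vector) set" where
  "Linf M = {w. strongly_measurable M w \<and> (\<exists>C. AE x in M. norm (w x) \<le> C)}"

definition Linf_norm :: "'a measure \<Rightarrow> ('a \<Rightarrow> 'e::real_normed_vector) \<Rightarrow> real" where
  "Linf_norm M w = Inf {C. 0 \<le> C \<and> (AE x in M. norm (w x) \<le> C)}"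

definition class_map ::
  "'a measure \<Rightarrow> ('a \<Rightarrow> 'e) set \<Rightarrow> ('a \<Rightarrow> 'e) set \<Rightarrow> (('a \<Rightarrow> 'e) \<Rightarrow> ('a \<Rightarrow> 'e)) \<Rightarrow> bool" where
  "class_map M V W T \<longleftrightarrow>
     (\<forall>u\<in>V. T u \<in> W) \<and>
     (\<forall>u\<in>V. \<forall>v\<in>V. (AE x in M. u x = v x) \<longrightarrow> (AE x in M. T u x = T v x))"

definition continuous_linear_Lp_Linf ::
  "'a measure \<Rightarrow> real \<Rightarrow> (('a \<Rightarrow> 'e::real_normed_vector) \<Rightarrow> ('a \<Rightarrow> 'e)) \<Rightarrow> bool" where
  "continuous_linear_Lp_Linf M p T \<longleftrightarrow>
     class_map M (Lp M p) (Linf M) T \<and>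
     (\<forall>u\<in>Lp M p. \<forall>v\<in>Lp M p. AE x in M. T (\<lambda>y. u y + v y) x = T u x + T v x) \<and>
     (\<forall>c. \<forall>u\<in>Lp M p. AE x in M. T (\<lambda>y. c *\<^sub>R u y) x = c *\<^sub>R T u x) \<and>
     (\<forall>u\<in>Lp M p. \<forall>\<epsilon>>0. \<exists>\<delta>>0. \<forall>v\<in>Lp M p.
        Lp_norm M p (\<lambda>x. v x - u x) < \<delta> \<longrightarrow> Linf_norm M (\<lambda>x. T v x - T u x) < \<epsilon>)"


text \<open>Continuous linear functionals on \<open>Lp M p\<close>. Continuity with respect to the seminorm makes
  them constant on classes modulo equality almost everywhere.\<close>

definition Lp_dual :: "'a measure \<Rightarrow> real \<Rightarrow> (('a \<Rightarrow> 'e::real_normed_vector) \<Rightarrow> real) set" where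
  "Lp_dual M p = {\<phi>.
     (\<forall>u\<in>Lp M p. \<forall>v\<in>Lp M p. \<phi> (\<lambda>x. u x + v x) = \<phi> u + \<phi> v) \<and>
     (\<forall>c. \<forall>u\<in>Lp M p. \<phi> (\<lambda>x. c *\<^sub>R u x) = c * \<phi> u) \<and>
     (\<forall>u\<in>Lp M p. \<forall>\<epsilon>>0. \<exists>\<delta>>0. \<forall>v\<in>Lp M p.
        Lp_norm M p (\<lambda>x. v x - u x) < \<delta> \<longrightarrow> \<bar>\<phi> v - \<phi> u\<bar> < \<epsilon>)}"

definition Lp_weak_conv ::
  "'a measure \<Rightarrow> real \<Rightarrow> (nat \<Rightarrow> 'a \<Rightarrow> 'e::real_normed_vector) \<Rightarrow> ('a \<Rightarrow> 'e) \<Rightarrow> bool" where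
  "Lp_weak_conv M p un u \<longleftrightarrow>
     (\<forall>n. un n \<in> Lp M p) \<and> u \<in> Lp M p \<and> (\<forall>\<phi>\<in>Lp_dual M p. (\<lambda>n. \<phi> (un n)) \<longlonglongrightarrow> \<phi> u)"

definition Lp_seq_weakly_continuous ::
  "'a measure \<Rightarrow> real \<Rightarrow> real \<Rightarrow> (('a \<Rightarrow> 'e::real_normed_vector) \<Rightarrow> ('a \<Rightarrow> 'e)) \<Rightarrow> bool" where
  "Lp_seq_weakly_continuous M p q T \<longleftrightarrow>
     (\<forall>un u. Lp_weak_conv M p un u \<longrightarrow> Lp_weak_conv M q (\<lambda>n. T (un n)) (T u))"

definition weak_conv :: "(nat \<Rightarrow> 'e::real_normed_vector) \<Rightarrow> 'e \<Rightarrow> bool" where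
  "weak_conv un u \<longleftrightarrow> (\<forall>\<phi> :: 'e \<Rightarrow> real. bounded_linear \<phi> \<longrightarrow> (\<lambda>n. \<phi> (un n)) \<longlonglongrightarrow> \<phi> u)"

definition seq_weakly_continuous :: "('e::real_normed_vector \<Rightarrow> 'e) \<Rightarrow> bool" where
  "seq_weakly_continuous g \<longleftrightarrow> (\<forall>un u. weak_conv un u \<longrightarrow> weak_conv (\<lambda>n. g (un n)) (g u))"

definition weak_caratheodory ::
  "'a measure \<Rightarrow> ('a \<Rightarrow> 'e::real_normed_vector \<Rightarrow> 'e) \<Rightarrow> bool" where
  "weak_caratheodory M f \<longleftrightarrow>
     (\<forall>u. strongly_measurable M (\<lambda>x. f x u)) \<and> (AE x in M. seq_weakly_continuous (f x))"

definition substitution_operator :: "('a \<Rightarrow> 'e \<Rightarrow> 'e) \<Rightarrow> ('a \<Rightarrow> 'e) \<Rightarrow> ('a \<Rightarrow> 'e)" where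
  "substitution_operator f w = (\<lambda>x. f x (w x))"

definition locally_bounded_on :: "real set \<Rightarrow> (real \<Rightarrow> real) \<Rightarrow> bool" where
  "locally_bounded_on S g \<longleftrightarrow> (\<forall>t\<in>S. \<exists>U. open U \<and> t \<in> U \<and> bounded (g ` (U \<inter> S)))"

end

theory Submission
  imports Defs "HOL-Library.Function_Algebras"
begin

text \<open>Two facts are combined. First, if \<open>u\<^sub>n \<rightharpoonup> u\<close> in \<open>L\<^sup>p\<close>, then \<open>I u\<^sub>n\<close> is bounded in \<open>L\<^sup>\<infinity>\<close>
  and \<open>I u\<^sub>n(x) \<rightharpoonup> I u(x)\<close> in \<open>E\<close> for almost every \<open>x\<close>. For one functional on \<open>E\<close> the convergence almost
  everywhere follows by separation in \<open>L\<^sup>p\<close>; countably many functionals suffice since the functions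
  are essentially separably valued and \<open>E\<close> is uniformly convex. Second, if functions \<open>v\<^sub>n\<close> with a common
  majorant in \<open>L\<^sup>q\<close> converge weakly in \<open>E\<close> at almost every point, then they converge weakly in \<open>L\<^sup>q\<close>.
  No duality theory of \<open>L\<^sup>q\<close> is needed for this: by uniform convexity, near-minimisers of an
  \<open>L\<^sup>2\<close>-norm over shrinking convex sets of functions converge almost everywhere in norm, and a
  subsequence on which a functional stays away from its limit yields such convex sets.
  The same device gives the strong measurability of \<open>x \<mapsto> f x (w x)\<close>.\<close>

subsection \<open>Sublinear functionals\<close>

text \<open>\<open>Lp M p\<close> is a carrier set with a seminorm inside a function type, and its
  functionals are linear on the carrier only. Separation and uniform boundedness are therefore set
  up for a seminorm on a subspace of a real vector space, and serve both the functions and their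
  values. The near-minimisers converge to the right limit because of the sets chosen: if the
  \<open>n\<close>-th set contains only functions whose value at \<open>x\<close> lies in the closed
  convex hull of the values of the \<open>v m\<close> at \<open>x\<close> for
  \<open>m \<ge> n\<close>, then a norm limit at \<open>x\<close> must be the weak limit there.
  These sets are merely closed under midpoints, so an inequality for an arbitrary functional can be
  built into them; it survives averaging and is refuted by norm convergence under the majorant. A
  Radon measure may fail to be sigma-finite; finiteness, which the minimisation requires, comes from
  the majorant. The countably many functionals on \<open>E\<close> are norming functionals of a
  countable set \<open>S\<close> whose closure contains the values and is closed under midpoints.
  They need not separate the points of \<open>E\<close>, but they recognise the limit
  \<open>0\<close> among the points of that closure.\<close>

locale real_linear_space = vector_space scale
  for scale :: "real \<Rightarrow> 'v::ab_group_add \<Rightarrow> 'v" (infixr \<open>*s\<close> 75)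
begin

definition sublinear_on :: "'v set \<Rightarrow> ('v \<Rightarrow> real) \<Rightarrow> bool" where
  "sublinear_on V N \<longleftrightarrow>
     (\<forall>x\<in>V. \<forall>y\<in>V. N (x + y) \<le> N x + N y) \<and> (\<forall>x\<in>V. \<forall>c\<ge>0. N (c *s x) = c * N x)"

definition seminorm_on :: "'v set \<Rightarrow> ('v \<Rightarrow> real) \<Rightarrow> bool" where
  "seminorm_on V N \<longleftrightarrow>
     (\<forall>x\<in>V. \<forall>y\<in>V. N (x + y) \<le> N x + N y) \<and> (\<forall>x\<in>V. \<forall>c. N (c *s x) = \<bar>c\<bar> * N x)"

definition linear_form_on :: "'v set \<Rightarrow> ('v \<Rightarrow> real) \<Rightarrow> bool" where
  "linear_form_on V \<phi> \<longleftrightarrow>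
     (\<forall>x\<in>V. \<forall>y\<in>V. \<phi> (x + y) = \<phi> x + \<phi> y) \<and> (\<forall>x\<in>V. \<forall>c. \<phi> (c *s x) = c * \<phi> x)"

definition convex_in :: "'v set \<Rightarrow> bool" where
  "convex_in K \<longleftrightarrow> (\<forall>x\<in>K. \<forall>y\<in>K. \<forall>t. 0 \<le> t \<and> t \<le> 1 \<longrightarrow> (1 - t) *s x + t *s y \<in> K)"

lemma sublinear_on_zero: "subspace V \<Longrightarrow> sublinear_on V N \<Longrightarrow> N 0 = 0"
  unfolding sublinear_on_def using subspace_0[of V] by (metis mult_zero_left order_refl scale_zero_left)

lemma sublinear_on_ge:
  assumes "subspace V" "sublinear_on V N" "x \<in> V"
  shows "- N (- x) \<le> N x"
proof -
  have "N (x + (- x)) \<le> N x + N (- x)"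
    using assms subspace_neg unfolding sublinear_on_def by blast
  then show ?thesis using sublinear_on_zero[OF assms(1,2)] by simp
qed

lemma seminorm_on_imp_sublinear: "seminorm_on V N \<Longrightarrow> sublinear_on V N"
  by (auto simp: seminorm_on_def sublinear_on_def)

lemma seminorm_on_minus: "seminorm_on V N \<Longrightarrow> x \<in> V \<Longrightarrow> N (- x) = N x"
  unfolding seminorm_on_def by (metis abs_minus_cancel abs_one mult_1 scale_minus_left scale_one)

lemma seminorm_on_nonneg:
  assumes "subspace V" "seminorm_on V N" "x \<in> V"
  shows "0 \<le> N x"
  using sublinear_on_ge[OF assms(1) seminorm_on_imp_sublinear[OF assms(2)] assms(3)]
    seminorm_on_minus[OF assms(2,3)] by simp

lemma linear_form_on_minus: "linear_form_on V \<phi> \<Longrightarrow> x \<in> V \<Longrightarrow> \<phi> (- x) = - \<phi> x"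
  unfolding linear_form_on_def by (metis mult_minus1 scale_minus_left scale_one)

text \<open>Take the infimum of \<open>N (v + t *s k) - t * \<epsilon>\<close> over
  \<open>t \<ge> 0\<close> and \<open>k \<in> K\<close>. It is finite because \<open>t * \<epsilon>
  \<le> N (t *s k) \<le> N (v + t *s k) + N (- v)\<close>, and \<open>t = 1\<close> at
  \<open>v = - k\<close> gives the strict gain. A linear form below it is at least
  \<open>\<epsilon>\<close> on \<open>K\<close>.\<close>

lemma exists_sublinear_below:
  assumes V: "subspace V" and N: "sublinear_on V N"
    and KV: "K \<subseteq> V" and cvx: "convex_in K" and ne: "K \<noteq> {}" and ge: "\<And>k. k \<in> K \<Longrightarrow> \<epsilon> \<le> N k"
  shows "\<exists>p. sublinear_on V p \<and> (\<forall>v\<in>V. p v \<le> N v) \<and> (\<forall>k\<in>K. p (- k) \<le> - \<epsilon>)"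
proof -
  obtain k0 where k0: "k0 \<in> K" using ne by blast
  define S where "S v = {N (v + t *s k) - t * \<epsilon> | t k. 0 \<le> t \<and> k \<in> K}" for v
  define p where "p v = Inf (S v)" for v
  have addN: "N (x + y) \<le> N x + N y" if "x \<in> V" "y \<in> V" for x y
    using N that unfolding sublinear_on_def by blast
  have scN: "N (c *s x) = c * N x" if "x \<in> V" "0 \<le> c" for x c
    using N that unfolding sublinear_on_def by blast
  note sub = subspace_add[OF V] subspace_scale[OF V] subspace_neg[OF V]
  have lower: "- N (- v) \<le> s" if v: "v \<in> V" and s: "s \<in> S v" for v s
  proof -
    obtain t k where tk: "s = N (v + t *s k) - t * \<epsilon>" "0 \<le> t" "k \<in> K"
      using s unfolding S_def by blast
    have kV: "k \<in> V" using tk KV by blast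
    have "N ((v + t *s k) + (- v)) \<le> N (v + t *s k) + N (- v)"
      using v kV by (intro addN sub) auto
    moreover have "N ((v + t *s k) + (- v)) = t * N k"
      using scN[OF kV tk(2)] by simp
    moreover have "t * \<epsilon> \<le> t * N k" using tk ge by (simp add: mult_left_mono)
    ultimately show ?thesis using tk(1) by linarith
  qed
  have bdd: "bdd_below (S v)" if "v \<in> V" for v
    using lower[OF that] by (rule bdd_belowI)
  have nonempty: "S v \<noteq> {}" for v
    using k0 unfolding S_def by blast
  have p_le: "p v \<le> s" if "v \<in> V" "s \<in> S v" for v s
    unfolding p_def using cInf_lower[OF that(2) bdd[OF that(1)]] .
  have p_leN: "p v \<le> N v" if "v \<in> V" for v
    using that k0 by (intro p_le) (auto simp: S_def intro!: exI[of _ "0::real"])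
  have p0: "p 0 = 0"
  proof (rule antisym)
    show "p 0 \<le> 0" using p_leN[OF subspace_0[OF V]] sublinear_on_zero[OF V N] by simp
    have "- N (- 0) \<le> p 0"
      unfolding p_def by (rule cInf_greatest[OF nonempty]) (rule lower[OF subspace_0[OF V]])
    then show "0 \<le> p 0" using sublinear_on_zero[OF V N] by simp
  qed
  have add: "p (x + y) \<le> p x + p y" if xy: "x \<in> V" "y \<in> V" for x y
  proof -
    have "p (x + y) \<le> s + s'" if s: "s \<in> S x" and s': "s' \<in> S y" for s s'
    proof -
      obtain t k where tk: "s = N (x + t *s k) - t * \<epsilon>" "0 \<le> t" "k \<in> K"
        using s unfolding S_def by blast
      obtain t' k' where tk': "s' = N (y + t' *s k') - t' * \<epsilon>" "0 \<le> t'" "k' \<in> K"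
        using s' unfolding S_def by blast
      have kV: "k \<in> V" "k' \<in> V" using tk tk' KV by auto
      \<comment> \<open>Convexity makes the sum of two multiples a single multiple of a point of
        \<open>K\<close>; if both coefficients vanish, any point will do.\<close>
      obtain k'' where k'': "k'' \<in> K" "(t + t') *s k'' = t *s k + t' *s k'"
      proof (cases "t + t' = 0")
        case True
        then show thesis using tk tk' that[of k0] k0 by (simp add: add_nonneg_eq_0_iff)
      next
        case False
        define r where "r = t' / (t + t')"
        have r: "0 \<le> r" "r \<le> 1" "(t + t') * r = t'" "(t + t') * (1 - r) = t"
          using tk tk' False by (auto simp: r_def field_simps)
        have "(1 - r) *s k + r *s k' \<in> K"
          using cvx tk tk' r unfolding convex_in_def by blast
        moreover have "(t + t') *s ((1 - r) *s k + r *s k') = t *s k + t' *s k'"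
          using r by (simp only: scale_right_distrib scale_scale)
        ultimately show thesis by (rule that)
      qed
      have "N (x + y + (t + t') *s k'') - (t + t') * \<epsilon> \<in> S (x + y)"
        unfolding S_def using tk tk' k'' by (intro CollectI exI[of _ "t+t'"] exI[of _ k'']) auto
      then have "p (x + y) \<le> N (x + y + (t + t') *s k'') - (t + t') * \<epsilon>"
        using xy by (intro p_le sub)
      also have "x + y + (t + t') *s k'' = (x + t *s k) + (y + t' *s k')"
        using k'' by (simp add: algebra_simps)
      also have "N ((x + t *s k) + (y + t' *s k')) \<le> N (x + t *s k) + N (y + t' *s k')"
        using xy kV by (intro addN sub)
      finally show ?thesis using tk tk' by (simp add: algebra_simps)
    qed
    then have "p (x + y) - s' \<le> p x" if "s' \<in> S y" for s'
      unfolding p_def[of x] using that by (intro cInf_greatest[OF nonempty]) (simp add: algebra_simps)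
    then have "p (x + y) - p x \<le> p y"
      unfolding p_def[of y] by (intro cInf_greatest[OF nonempty]) (simp add: algebra_simps)
    then show ?thesis by simp
  qed
  have sc_le: "p (c *s x) \<le> c * p x" if x: "x \<in> V" and c: "0 < c" for c x
  proof -
    have "p (c *s x) / c \<le> s" if s: "s \<in> S x" for s
    proof -
      obtain t k where tk: "s = N (x + t *s k) - t * \<epsilon>" "0 \<le> t" "k \<in> K"
        using s unfolding S_def by blast
      have kV: "k \<in> V" using tk KV by auto
      have "N (c *s x + (c * t) *s k) - (c * t) * \<epsilon> \<in> S (c *s x)"
        unfolding S_def using tk c by (intro CollectI exI[of _ "c*t"] exI[of _ k]) auto
      then have "p (c *s x) \<le> N (c *s x + (c * t) *s k) - (c * t) * \<epsilon>"
        using x by (intro p_le sub)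
      also have "c *s x + (c * t) *s k = c *s (x + t *s k)"
        by (simp add: scale_right_distrib)
      also have "N (c *s (x + t *s k)) = c * N (x + t *s k)"
        using x kV c by (intro scN sub) auto
      also have "c * N (x + t *s k) - c * t * \<epsilon> = c * s"
        unfolding tk(1) by (simp add: algebra_simps)
      finally show ?thesis using c by (simp add: field_simps)
    qed
    then have "p (c *s x) / c \<le> p x"
      unfolding p_def[of x] by (intro cInf_greatest[OF nonempty])
    then show ?thesis using c by (simp add: field_simps)
  qed
  have sc: "p (c *s x) = c * p x" if x: "x \<in> V" and c: "0 \<le> c" for c x
  proof (cases "c = 0")
    case True
    then show ?thesis by (simp add: p0)
  next
    case False
    then have c': "0 < c" using c by simp
    have "p ((1/c) *s (c *s x)) \<le> (1/c) * p (c *s x)"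
      using x c' by (intro sc_le sub) auto
    then have "c * p x \<le> p (c *s x)" using c' by (simp add: field_simps)
    then show ?thesis using sc_le[OF x c'] by simp
  qed
  have "p (- k) \<le> - \<epsilon>" if "k \<in> K" for k
  proof -
    have "N (- k + 1 *s k) - 1 * \<epsilon> \<in> S (- k)"
      unfolding S_def using that by (intro CollectI exI[of _ 1] exI[of _ k]) auto
    then have "p (- k) \<le> N (- k + 1 *s k) - 1 * \<epsilon>"
      using that KV by (intro p_le sub) auto
    then show ?thesis using sublinear_on_zero[OF V N] by simp
  qed
  then show ?thesis using add sc p_leN unfolding sublinear_on_def by blast
qed

text \<open>A minimal element among the sublinear functionals below \<open>N\<close> is linear.\<close>

lemma exists_linear_form_below:
  assumes V: "subspace V" and N: "sublinear_on V N"
  shows "\<exists>\<phi>. linear_form_on V \<phi> \<and> (\<forall>v\<in>V. \<phi> v \<le> N v)"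
proof -
  \<comment> \<open>Fixing the value \<open>0\<close> outside \<open>V\<close> makes the pointwise
    order on total functions agree with the order on \<open>V\<close>. Since Zorn's lemma yields a
    maximal element, \<open>P\<close> is the reversed order.\<close>
  define A where "A = {q. sublinear_on V q \<and> (\<forall>v\<in>V. q v \<le> N v) \<and> (\<forall>v. v \<notin> V \<longrightarrow> q v = 0)}"
  define P :: "('v \<Rightarrow> real) \<Rightarrow> ('v \<Rightarrow> real) \<Rightarrow> bool" where "P q r \<longleftrightarrow> r \<le> q" for q r
  have cut: "(\<lambda>v. if v \<in> V then q v else 0) \<in> A"
    if "sublinear_on V q" "\<And>v. v \<in> V \<Longrightarrow> q v \<le> N v" for q
    using that subspace_add[OF V] subspace_scale[OF V] unfolding A_def sublinear_on_def by auto
  have po: "partial_order_on A (relation_of P A)"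
    unfolding partial_order_on_def preorder_on_def refl_on_def trans_def antisym_def
      relation_of_def P_def by auto
  have "\<exists>m\<in>A. \<forall>a\<in>A. P m a \<longrightarrow> a = m"
  proof (rule predicate_Zorn[OF po])
    fix C assume C: "C \<in> Chains (relation_of P A)"
    then have CA: "C \<subseteq> A"
      unfolding Chains_def relation_of_def by auto
    have tot: "q \<le> r \<or> r \<le> q" if "q \<in> C" "r \<in> C" for q r
      using C that unfolding Chains_def relation_of_def P_def by auto
    show "\<exists>u\<in>A. \<forall>a\<in>C. P a u"
    proof (cases "C = {}")
      case True
      then show ?thesis using cut[OF N] by auto
    next
      case False
      define u where "u v = (INF q\<in>C. q v)" for v
      have qC: "sublinear_on V q" "\<And>v. v \<in> V \<Longrightarrow> q v \<le> N v" "\<And>v. v \<notin> V \<Longrightarrow> q v = 0"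
        if "q \<in> C" for q
        using that CA unfolding A_def by auto
      have bdd: "bdd_below ((\<lambda>q. q v) ` C)" if v: "v \<in> V" for v
      proof (rule bdd_belowI2)
        fix q assume q: "q \<in> C"
        show "- N (- v) \<le> q v"
          using sublinear_on_ge[OF V qC(1)[OF q] v] qC(2)[OF q subspace_neg[OF V v]] by linarith
      qed
      have u_le: "u v \<le> q v" if "q \<in> C" "v \<in> V" for q v
        unfolding u_def by (rule cINF_lower[OF bdd]) (use that in auto)
      have u_ge: "c \<le> u v" if "\<And>q. q \<in> C \<Longrightarrow> c \<le> q v" for c v
        unfolding u_def using False that by (intro cINF_greatest) auto
      have sub: "sublinear_on V u"
        unfolding sublinear_on_def
      proof (intro conjI ballI allI impI)
        fix x y assume xy: "x \<in> V" "y \<in> V"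
        have "u (x + y) - r y \<le> q x" if qr: "q \<in> C" "r \<in> C" for q r
        proof -
          obtain s where s: "s \<in> C" "s \<le> q" "s \<le> r"
            using tot[OF qr] qr by auto
          have "u (x + y) \<le> s (x + y)"
            using s xy subspace_add[OF V] by (intro u_le) auto
          also have "\<dots> \<le> s x + s y"
            using qC(1)[OF s(1)] xy unfolding sublinear_on_def by blast
          also have "\<dots> \<le> q x + r y"
            using s unfolding le_fun_def by (intro add_mono) auto
          finally show ?thesis by simp
        qed
        then have "u (x + y) - r y \<le> u x" if "r \<in> C" for r
          using that by (intro u_ge)
        then have "u (x + y) - u x \<le> u y"
          by (intro u_ge) (simp add: algebra_simps)
        then show "u (x + y) \<le> u x + u y" by simp
      next
        fix x and c :: real assume x: "x \<in> V" and c: "0 \<le> c"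
        show "u (c *s x) = c * u x"
        proof (rule antisym)
          have le: "u (c *s x) \<le> c * q x" if "q \<in> C" for q
            using u_le[OF that subspace_scale[OF V x]] qC(1)[OF that] x c
            unfolding sublinear_on_def by metis
          show "u (c *s x) \<le> c * u x"
          proof (cases "c = 0")
            case True
            then show ?thesis using le False by auto
          next
            case c0: False
            have "u (c *s x) / c \<le> u x"
              using le c c0 by (intro u_ge) (simp add: field_simps)
            then show ?thesis using c c0 by (simp add: field_simps)
          qed
          show "c * u x \<le> u (c *s x)"
          proof (rule u_ge)
            fix q assume q: "q \<in> C"
            have "q (c *s x) = c * q x"
              using qC(1)[OF q] x c unfolding sublinear_on_def by blast
            then show "c * u x \<le> q (c *s x)"
              using mult_left_mono[OF u_le[OF q x] c] by simp
          qed
        qed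
      qed
      moreover have "u v \<le> N v" if v: "v \<in> V" for v
      proof -
        obtain q where q: "q \<in> C" using False by blast
        show ?thesis using u_le[OF q v] qC(2)[OF q v] by linarith
      qed
      ultimately have "(\<lambda>v. if v \<in> V then u v else 0) \<in> A" by (rule cut)
      moreover have "P q (\<lambda>v. if v \<in> V then u v else 0)" if "q \<in> C" for q
        using that u_le[OF that] qC(3)[OF that] unfolding P_def le_fun_def by auto
      ultimately show ?thesis by blast
    qed
  qed
  then obtain m where mA: "m \<in> A" and min: "\<And>a. a \<in> A \<Longrightarrow> a \<le> m \<Longrightarrow> a = m"
    unfolding P_def by blast
  have m: "sublinear_on V m" "\<And>v. v \<in> V \<Longrightarrow> m v \<le> N v" "\<And>v. v \<notin> V \<Longrightarrow> m v = 0"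
    using mA unfolding A_def by auto
  \<comment> \<open>The previous construction for the single point \<open>y\<close> and
    \<open>\<epsilon> = m y\<close> gives a sublinear functional below \<open>m\<close>. By
    minimality it equals \<open>m\<close>, so \<open>m (- y) \<le> - m y\<close>; the other
    inequality is subadditivity.\<close>
  have neg: "m (- y) = - m y" if y: "y \<in> V" for y
  proof -
    have "\<exists>p. sublinear_on V p \<and> (\<forall>v\<in>V. p v \<le> m v) \<and> (\<forall>k\<in>{y}. p (- k) \<le> - m y)"
      using V m y by (intro exists_sublinear_below)
        (auto simp: convex_in_def simp flip: scale_left_distrib)
    then obtain p where p: "sublinear_on V p" "\<And>v. v \<in> V \<Longrightarrow> p v \<le> m v" "p (- y) \<le> - m y"
      by blast
    have eq: "(\<lambda>v. if v \<in> V then p v else 0) = m"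
    proof (rule min)
      show "(\<lambda>v. if v \<in> V then p v else 0) \<in> A"
        using p m by (intro cut) (auto intro: order_trans)
      show "(\<lambda>v. if v \<in> V then p v else 0) \<le> m"
        using p m unfolding le_fun_def by auto
    qed
    have "p (- y) = m (- y)" using fun_cong[OF eq, of "- y"] subspace_neg[OF V y] by simp
    then show ?thesis using p(3) sublinear_on_ge[OF V m(1) y] by simp
  qed
  have "linear_form_on V m"
    unfolding linear_form_on_def
  proof (intro conjI ballI allI)
    fix x y assume xy: "x \<in> V" "y \<in> V"
    have "m ((x + y) + (- y)) \<le> m (x + y) + m (- y)"
      using m(1) subspace_add[OF V xy] subspace_neg[OF V xy(2)] unfolding sublinear_on_def by blast
    moreover have "m (x + y) \<le> m x + m y"
      using m(1) xy unfolding sublinear_on_def by blast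
    ultimately show "m (x + y) = m x + m y"
      using neg[OF xy(2)] by simp
  next
    fix x c assume x: "x \<in> V"
    show "m (c *s x) = c * m x"
    proof (cases "0 \<le> c")
      case True
      then show ?thesis using m(1) x unfolding sublinear_on_def by blast
    next
      case False
      then have "m ((- c) *s x) = (- c) * m x"
        using m(1) x unfolding sublinear_on_def by (metis neg_0_le_iff_le linear)
      then show ?thesis using neg[OF subspace_scale[OF V x, of c]] by (simp add: scale_minus_left)
    qed
  qed
  then show ?thesis using m(2) by blast
qed

text \<open>A linear form below the sublinear functional \<open>p\<close> inherits
  \<open>\<phi> (- k) \<le> p (- k) \<le> - \<epsilon>\<close>, and \<open>p \<le> N\<close> bounds
  it on both sides because \<open>N\<close> is symmetric.\<close>

lemma separating_linear_form:
  assumes V: "subspace V" and N: "seminorm_on V N"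
    and KV: "K \<subseteq> V" and cvx: "convex_in K" and ne: "K \<noteq> {}" and ge: "\<And>k. k \<in> K \<Longrightarrow> \<epsilon> \<le> N k"
  obtains \<phi> where "linear_form_on V \<phi>" "\<And>v. v \<in> V \<Longrightarrow> \<bar>\<phi> v\<bar> \<le> N v" "\<And>k. k \<in> K \<Longrightarrow> \<epsilon> \<le> \<phi> k"
proof -
  obtain p where p: "sublinear_on V p" "\<And>v. v \<in> V \<Longrightarrow> p v \<le> N v" "\<And>k. k \<in> K \<Longrightarrow> p (- k) \<le> - \<epsilon>"
    using exists_sublinear_below[OF V seminorm_on_imp_sublinear[OF N] KV cvx ne ge] by blast
  obtain \<phi> where \<phi>: "linear_form_on V \<phi>" "\<And>v. v \<in> V \<Longrightarrow> \<phi> v \<le> p v"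
    using exists_linear_form_below[OF V p(1)] by blast
  have le: "\<phi> v \<le> N v" if "v \<in> V" for v
    using \<phi>(2)[OF that] p(2)[OF that] by linarith
  show thesis
  proof
    show "linear_form_on V \<phi>" by fact
    show "\<bar>\<phi> v\<bar> \<le> N v" if v: "v \<in> V" for v
      using le[OF v] le[OF subspace_neg[OF V v]] linear_form_on_minus[OF \<phi>(1) v]
        seminorm_on_minus[OF N v] by linarith
    show "\<epsilon> \<le> \<phi> k" if k: "k \<in> K" for k
    proof -
      have kV: "k \<in> V" using k KV by blast
      show ?thesis
        using \<phi>(2)[OF subspace_neg[OF V kV]] p(3)[OF k] linear_form_on_minus[OF \<phi>(1) kV] by linarith
    qed
  qed
qed

lemma norming_linear_form:
  assumes "subspace V" "seminorm_on V N" "y \<in> V"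
  obtains \<phi> where "linear_form_on V \<phi>" "\<And>v. v \<in> V \<Longrightarrow> \<bar>\<phi> v\<bar> \<le> N v" "\<phi> y = N y"
proof (rule separating_linear_form[of V N "{y}" "N y"])
  show "convex_in {y}" by (simp add: convex_in_def flip: scale_left_distrib)
  fix \<phi> assume \<phi>: "linear_form_on V \<phi>" "\<And>v. v \<in> V \<Longrightarrow> \<bar>\<phi> v\<bar> \<le> N v" "\<And>k. k \<in> {y} \<Longrightarrow> N y \<le> \<phi> k"
  have "\<phi> y = N y" using \<phi>(2)[OF assms(3)] \<phi>(3)[of y] by simp
  with \<phi>(1,2) show thesis by (rule that)
qed (use assms in auto)

text \<open>Sokal's proof of the uniform boundedness theorem: with norming forms \<open>\<phi> k\<close> of members \<open>y k\<close> of the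
  sequence, the terms of \<open>\<Sum>k. \<plusminus> (1/3) ^ k * \<phi> k / 2\<close> get their signs one after the other, such that
  the \<open>k\<close>-th partial sum is large at \<open>y k\<close>; the tail is too small to cancel this.\<close>

lemma weakly_bounded_imp_bounded:
  assumes V: "subspace V" and N: "seminorm_on V N" and zV: "\<And>n::nat. z n \<in> V"
    and bdd: "\<And>\<phi>. linear_form_on V \<phi> \<Longrightarrow> (\<And>v. v \<in> V \<Longrightarrow> \<bar>\<phi> v\<bar> \<le> N v) \<Longrightarrow> \<exists>C. \<forall>n. \<bar>\<phi> (z n)\<bar> \<le> C"
  obtains C where "\<And>n. N (z n) \<le> C"
proof (rule ccontr)
  assume contr: "\<not> thesis"
  \<comment> \<open>The base \<open>4\<close> must exceed the reciprocal \<open>3\<close> of the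
    ratio of the series, so that the products \<open>4 ^ k * (1/3) ^ k\<close> still grow.\<close>
  have "\<exists>n. 4 ^ k \<le> N (z n)" for k :: nat
  proof (rule ccontr)
    assume "\<nexists>n. 4 ^ k \<le> N (z n)"
    then have "N (z n) \<le> 4 ^ k" for n by (simp add: not_le order_less_imp_le)
    then show False using contr that by blast
  qed
  then obtain r where r: "\<And>k::nat. 4 ^ k \<le> N (z (r k))" by metis
  define y where "y k = z (r k)" for k
  have yV: "y k \<in> V" for k using zV y_def by simp
  have "\<exists>\<phi>. linear_form_on V \<phi> \<and> (\<forall>v\<in>V. \<bar>\<phi> v\<bar> \<le> N v) \<and> \<phi> (y k) = N (y k)" for k
    using norming_linear_form[OF V N yV] by metis
  then obtain \<phi> where \<phi>: "\<And>k. linear_form_on V (\<phi> k)" "\<And>k v. v \<in> V \<Longrightarrow> \<bar>\<phi> k v\<bar> \<le> N v"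
    "\<And>k. \<phi> k (y k) = N (y k)" by metis
  note Nn = seminorm_on_nonneg[OF V N]
  \<comment> \<open>The sign is the one with the larger value at the new point, since
    \<open>max \<bar>a + b\<bar> \<bar>a - b\<bar> \<ge> b\<close>. The factor \<open>1/2\<close>
    keeps the total weight of the series at \<open>3/4\<close>, so that the limit is still dominated
    by \<open>N\<close>.\<close>
  define \<sigma> where "\<sigma> = rec_nat (\<lambda>v. \<phi> 0 v / 2) (\<lambda>k s.
     if \<bar>s (y (Suc k)) - \<phi> (Suc k) (y (Suc k)) * (1/3) ^ Suc k / 2\<bar> \<le> \<bar>s (y (Suc k)) + \<phi> (Suc k) (y (Suc k)) * (1/3) ^ Suc k / 2\<bar>
     then (\<lambda>v. s v + \<phi> (Suc k) v * (1/3) ^ Suc k / 2) else (\<lambda>v. s v - \<phi> (Suc k) v * (1/3) ^ Suc k / 2))"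
  have \<sigma>0: "\<sigma> 0 = (\<lambda>v. \<phi> 0 v / 2)" by (simp add: \<sigma>_def)
  have \<sigma>_cases: "\<sigma> (Suc k) = (\<lambda>v. \<sigma> k v + \<phi> (Suc k) v * (1/3) ^ Suc k / 2) \<or>
      \<sigma> (Suc k) = (\<lambda>v. \<sigma> k v - \<phi> (Suc k) v * (1/3) ^ Suc k / 2)" for k
    by (auto simp: \<sigma>_def)
  have \<sigma>_big: "N (y k) * (1/3) ^ k / 2 \<le> \<bar>\<sigma> k (y k)\<bar>" for k
  proof (cases k)
    case 0
    then show ?thesis using \<phi>(3)[of 0] Nn[OF yV, of 0] by (simp add: \<sigma>0)
  next
    case (Suc j)
    have "\<bar>\<sigma> k (y k)\<bar> = max \<bar>\<sigma> j (y k) + \<phi> k (y k) * (1/3) ^ k / 2\<bar> \<bar>\<sigma> j (y k) - \<phi> k (y k) * (1/3) ^ k / 2\<bar>"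
      unfolding Suc by (simp add: \<sigma>_def max_def)
    moreover have "b \<le> max \<bar>a + b\<bar> \<bar>a - b\<bar>" for a b :: real
      by (auto simp: max_def)
    ultimately show ?thesis using \<phi>(3)[of k] by metis
  qed
  have lin: "linear_form_on V (\<sigma> k)" for k
  proof (induction k)
    case 0
    show ?case using \<phi>(1)[of 0] by (auto simp: \<sigma>0 linear_form_on_def field_simps)
  next
    case (Suc k)
    show ?case
      using \<sigma>_cases[of k] Suc \<phi>(1)[of "Suc k"] unfolding linear_form_on_def
      by (elim disjE) (simp_all add: field_simps)
  qed
  have step: "\<bar>\<sigma> (Suc k) v - \<sigma> k v\<bar> \<le> N v * (1/3) ^ Suc k / 2" if "v \<in> V" for v k
  proof -
    have "\<bar>\<sigma> (Suc k) v - \<sigma> k v\<bar> = \<bar>\<phi> (Suc k) v\<bar> * ((1/3) ^ Suc k / 2)"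
      using \<sigma>_cases[of k] by (auto simp: abs_mult)
    also have "\<dots> \<le> N v * ((1/3) ^ Suc k / 2)"
      using \<phi>(2)[OF that] by (intro mult_right_mono) auto
    finally show ?thesis by simp
  qed
  \<comment> \<open>The right-hand side is the exact partial sum of the geometric series; with the
    cruder limit \<open>1/4\<close> alone the induction would not close.\<close>
  have dist: "\<bar>\<sigma> (k + n) v - \<sigma> k v\<bar> \<le> N v * (1/3) ^ k * (1 - (1/3) ^ n) / 4" if "v \<in> V" for v k n
  proof (induction n)
    case (Suc n)
    have "\<bar>\<sigma> (k + Suc n) v - \<sigma> k v\<bar> \<le> \<bar>\<sigma> (Suc (k + n)) v - \<sigma> (k + n) v\<bar> + \<bar>\<sigma> (k + n) v - \<sigma> k v\<bar>"
      by simp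
    also have "\<dots> \<le> N v * (1/3) ^ Suc (k + n) / 2 + N v * (1/3) ^ k * (1 - (1/3) ^ n) / 4"
      using step[OF that] Suc by (intro add_mono) auto
    also have "\<dots> = N v * (1/3) ^ k * (1 - (1/3) ^ Suc n) / 4"
      by (simp add: field_simps power_add)
    finally show ?case .
  qed simp
  have dist': "\<bar>\<sigma> m v - \<sigma> k v\<bar> \<le> N v * (1/3) ^ k / 4" if "v \<in> V" "k \<le> m" for v k m
  proof -
    have "0 \<le> N v * (1/3) ^ k * (1/3) ^ (m - k)" using Nn[OF that(1)] by simp
    moreover have "\<bar>\<sigma> m v - \<sigma> k v\<bar> \<le> N v * (1/3) ^ k * (1 - (1/3) ^ (m - k)) / 4"
      using dist[OF that(1), of k "m - k"] that(2) by simp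
    ultimately show ?thesis by (simp add: right_diff_distrib)
  qed
  have conv: "convergent (\<lambda>k. \<sigma> k v)" if "v \<in> V" for v
  proof -
    have "summable (\<lambda>k. \<sigma> (Suc k) v - \<sigma> k v)"
    proof (rule summable_comparison_test')
      show "summable (\<lambda>k. (N v / 6) * (1/3::real) ^ k)"
        by (intro summable_mult summable_geometric) simp
      show "norm (\<sigma> (Suc k) v - \<sigma> k v) \<le> (N v / 6) * (1/3::real) ^ k" for k
        using step[OF that, of k] by simp
    qed
    then have "convergent (\<lambda>n. \<Sum>k<n. \<sigma> (Suc k) v - \<sigma> k v)" by (simp add: summable_iff_convergent)
    then have "convergent (\<lambda>n. (\<sigma> n v - \<sigma> 0 v) + \<sigma> 0 v)"
      unfolding sum_lessThan_telescope[of "\<lambda>k. \<sigma> k v"] by (intro convergent_add convergent_const)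
    then show ?thesis by simp
  qed
  define \<Phi> where "\<Phi> v = lim (\<lambda>k. \<sigma> k v)" for v
  have lim: "(\<lambda>k. \<sigma> k v) \<longlonglongrightarrow> \<Phi> v" if "v \<in> V" for v
    unfolding \<Phi>_def using conv[OF that] by (simp add: convergent_LIMSEQ_iff)
  have tail: "\<bar>\<Phi> v - \<sigma> k v\<bar> \<le> N v * (1/3) ^ k / 4" if "v \<in> V" for v k
  proof (rule Lim_bounded)
    show "(\<lambda>m. \<bar>\<sigma> m v - \<sigma> k v\<bar>) \<longlonglongrightarrow> \<bar>\<Phi> v - \<sigma> k v\<bar>"
      by (intro tendsto_intros lim that)
    show "\<forall>m\<ge>k. \<bar>\<sigma> m v - \<sigma> k v\<bar> \<le> N v * (1/3) ^ k / 4"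
      using dist' that by blast
  qed
  have "linear_form_on V \<Phi>"
    unfolding linear_form_on_def
  proof (intro conjI ballI allI)
    fix x y assume xy: "x \<in> V" "y \<in> V"
    have "(\<lambda>k. \<sigma> k (x + y)) \<longlonglongrightarrow> \<Phi> x + \<Phi> y"
      using tendsto_add[OF lim[OF xy(1)] lim[OF xy(2)]] lin xy unfolding linear_form_on_def by simp
    then show "\<Phi> (x + y) = \<Phi> x + \<Phi> y"
      using lim[OF subspace_add[OF V xy]] LIMSEQ_unique by blast
  next
    fix x c assume x: "x \<in> V"
    have "(\<lambda>k. \<sigma> k (c *s x)) \<longlonglongrightarrow> c * \<Phi> x"
      using tendsto_mult_left[OF lim[OF x], of c] lin x unfolding linear_form_on_def by simp
    then show "\<Phi> (c *s x) = c * \<Phi> x"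
      using lim[OF subspace_scale[OF V x]] LIMSEQ_unique by blast
  qed
  moreover have "\<bar>\<Phi> v\<bar> \<le> N v" if "v \<in> V" for v
  proof -
    have "\<bar>\<Phi> v - \<phi> 0 v / 2\<bar> \<le> N v / 4" using tail[OF that, of 0] by (simp add: \<sigma>0)
    then show ?thesis using \<phi>(2)[OF that, of 0] Nn[OF that] by linarith
  qed
  ultimately obtain C where C: "\<And>n. \<bar>\<Phi> (z n)\<bar> \<le> C" using bdd by blast
  \<comment> \<open>The \<open>k\<close>-th partial sum contributes at least one half of
    \<open>N (y k) * (1/3) ^ k\<close>, the tail removes at most a quarter, and a quarter
    remains.\<close>
  have le: "(4/3) ^ k / 4 \<le> C" for k :: nat
  proof -
    have "(4/3) ^ k = 4 ^ k * (1/3::real) ^ k" by (simp add: power_divide)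
    also have "\<dots> \<le> N (y k) * (1/3) ^ k" using r[of k] by (intro mult_right_mono) (auto simp: y_def)
    also have "\<dots> \<le> 4 * \<bar>\<Phi> (y k)\<bar>"
      using \<sigma>_big[of k] tail[OF yV, of k k] by linarith
    also have "\<dots> \<le> 4 * C" using C by (simp add: y_def)
    finally show ?thesis by simp
  qed
  obtain k where "4 * C < (4/3::real) ^ k"
    using real_arch_pow[of "4/3" "4 * C"] by auto
  then show False using le[of k] by linarith
qed

end

subsection \<open>Pointwise limits of simple functions\<close>

text \<open>Strong measurability without an exceptional set. Such functions are Borel measurable
  even if \<open>M\<close> is not complete, so integrals can be computed with them; every strongly
  measurable function agrees with one almost everywhere.\<close>

definition simple_limit :: "'a measure \<Rightarrow> ('a \<Rightarrow> 'b::topological_space) \<Rightarrow> bool" where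
  "simple_limit M w \<longleftrightarrow>
     (\<exists>s. (\<forall>n::nat. simple_function M (s n)) \<and> (\<forall>x\<in>space M. (\<lambda>n. s n x) \<longlonglongrightarrow> w x))"

lemma simple_limit_simple: "simple_function M s \<Longrightarrow> simple_limit M s"
  unfolding simple_limit_def by (intro exI[of _ "\<lambda>_. s"]) auto

lemma simple_limit_const: "simple_limit M (\<lambda>_. c)"
  by (intro simple_limit_simple) simp

lemma simple_limit_borel_measurable:
  fixes w :: "'a \<Rightarrow> 'b::metric_space"
  assumes "simple_limit M w" shows "w \<in> borel_measurable M"
  using assms unfolding simple_limit_def
  by (metis borel_measurable_LIMSEQ_metric borel_measurable_simple_function)

lemma simple_limit_real:
  fixes r :: "'a \<Rightarrow> real"
  assumes "r \<in> borel_measurable M" shows "simple_limit M r"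
  using borel_measurable_implies_sequence_metric[OF assms, of 0]
  unfolding simple_limit_def by blast

lemma simple_limit_compose2:
  fixes h :: "'b::topological_space \<Rightarrow> 'c::topological_space \<Rightarrow> 'd::topological_space"
  assumes "simple_limit M u" "simple_limit M v"
    and h: "\<And>X Y x y. X \<longlonglongrightarrow> x \<Longrightarrow> Y \<longlonglongrightarrow> y \<Longrightarrow> (\<lambda>n. h (X n) (Y n)) \<longlonglongrightarrow> h x y"
  shows "simple_limit M (\<lambda>x. h (u x) (v x))"
proof -
  obtain s t where s: "\<And>n::nat. simple_function M (s n)" "\<And>x. x \<in> space M \<Longrightarrow> (\<lambda>n. s n x) \<longlonglongrightarrow> u x"
    and t: "\<And>n::nat. simple_function M (t n)" "\<And>x. x \<in> space M \<Longrightarrow> (\<lambda>n. t n x) \<longlonglongrightarrow> v x"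
    using assms(1,2) unfolding simple_limit_def by metis
  show ?thesis
    unfolding simple_limit_def
    by (intro exI[of _ "\<lambda>n x. h (s n x) (t n x)"] conjI allI ballI h s t
        simple_function_compose2[where h=h])
qed

lemmas simple_limit_add = simple_limit_compose2[where h="(+) :: 'b \<Rightarrow> 'b \<Rightarrow> 'b::real_normed_vector", OF _ _ tendsto_add]
lemmas simple_limit_diff = simple_limit_compose2[where h="(-) :: 'b \<Rightarrow> 'b \<Rightarrow> 'b::real_normed_vector", OF _ _ tendsto_diff]
lemmas simple_limit_scaleR = simple_limit_compose2[where h="scaleR :: real \<Rightarrow> 'b \<Rightarrow> 'b::real_normed_vector", OF _ _ tendsto_scaleR]

section \<open>Limits everywhere and limits almost everywhere\<close>

lemma simple_limit_imp_strongly_measurable: "simple_limit M w \<Longrightarrow> strongly_measurable M w"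
  unfolding simple_limit_def strongly_measurable_def by blast

lemma strongly_measurable_cong_AE:
  assumes "strongly_measurable M u" "AE x in M. u x = v x"
  shows "strongly_measurable M v"
proof -
  obtain s where s: "\<And>n::nat. simple_function M (s n)" "AE x in M. (\<lambda>n. s n x) \<longlonglongrightarrow> u x"
    using assms(1) unfolding strongly_measurable_def by blast
  have "AE x in M. (\<lambda>n. s n x) \<longlonglongrightarrow> v x"
    using s(2) assms(2) by eventually_elim simp
  then show ?thesis using s(1) unfolding strongly_measurable_def by blast
qed

lemma strongly_measurable_obtain_simple_limit:
  assumes "strongly_measurable M w"
  obtains w' where "simple_limit M w'" "AE x in M. w x = w' x"
proof -
  obtain s where s: "\<And>n::nat. simple_function M (s n)" "AE x in M. (\<lambda>n. s n x) \<longlonglongrightarrow> w x"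
    using assms unfolding strongly_measurable_def by blast
  obtain N where N: "N \<in> null_sets M" "{x\<in>space M. \<not> (\<lambda>n. s n x) \<longlonglongrightarrow> w x} \<subseteq> N"
    using s(2) unfolding eventually_ae_filter by blast
  define w' where "w' x = (if x \<in> N then 0 else w x)" for x
  have "simple_limit M w'"
    unfolding simple_limit_def
  proof (intro exI[of _ "\<lambda>n x. if x \<in> N then 0 else s n x"] conjI allI ballI)
    have "N \<in> sets M" using N(1) by auto
    then show "simple_function M (\<lambda>x. if x \<in> N then 0 else s n x)" for n
      using s(1) by (intro simple_function_If_set) auto
    show "(\<lambda>n. if x \<in> N then 0 else s n x) \<longlonglongrightarrow> w' x" if "x \<in> space M" for x
      using N(2) that unfolding w'_def by auto
  qed
  moreover have "AE x in M. w x = w' x"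
    using AE_not_in[OF N(1)] by eventually_elim (simp add: w'_def)
  ultimately show thesis by (rule that)
qed

lemma strongly_measurable_compose2:
  fixes h :: "'b::real_normed_vector \<Rightarrow> 'c::real_normed_vector \<Rightarrow> 'd::real_normed_vector"
  assumes u: "strongly_measurable M u" and v: "strongly_measurable M v"
    and h: "\<And>X Y x y. X \<longlonglongrightarrow> x \<Longrightarrow> Y \<longlonglongrightarrow> y \<Longrightarrow> (\<lambda>n. h (X n) (Y n)) \<longlonglongrightarrow> h x y"
  shows "strongly_measurable M (\<lambda>x. h (u x) (v x))"
proof -
  obtain u' where u': "simple_limit M u'" "AE x in M. u x = u' x"
    using strongly_measurable_obtain_simple_limit[OF u] by blast
  obtain v' where v': "simple_limit M v'" "AE x in M. v x = v' x"
    using strongly_measurable_obtain_simple_limit[OF v] by blast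
  have "strongly_measurable M (\<lambda>x. h (u' x) (v' x))"
    by (intro simple_limit_imp_strongly_measurable simple_limit_compose2[where h=h] u' v' h)
  moreover have "AE x in M. h (u' x) (v' x) = h (u x) (v x)"
    using u'(2) v'(2) by eventually_elim simp
  ultimately show ?thesis by (rule strongly_measurable_cong_AE)
qed

lemma strongly_measurable_add:
  "strongly_measurable M u \<Longrightarrow> strongly_measurable M v \<Longrightarrow> strongly_measurable M (\<lambda>x. u x + v x)"
  by (rule strongly_measurable_compose2) (auto intro: tendsto_add)

lemma strongly_measurable_scaleR:
  "strongly_measurable M u \<Longrightarrow> strongly_measurable M (\<lambda>x. c *\<^sub>R u x)"
  by (rule strongly_measurable_compose2[where h="\<lambda>x _. c *\<^sub>R x" and v=u])
    (auto intro!: tendsto_intros)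

section \<open>Convergence almost everywhere on finite measure spaces\<close>

lemma summable_dist_imp_convergent:
  fixes w :: "nat \<Rightarrow> 'b::banach"
  assumes "\<forall>\<^sub>F n in sequentially. norm (w (Suc n) - w n) \<le> (1/2) ^ n"
  shows "convergent w"
proof -
  have "summable (\<lambda>n. w (Suc n) - w n)"
    using assms by (rule summable_comparison_test_ev) (simp add: summable_geometric)
  then have "convergent (\<lambda>n. \<Sum>k<n. w (Suc k) - w k)" by (simp add: summable_iff_convergent)
  then have "convergent (\<lambda>n. (w n - w 0) + w 0)"
    unfolding sum_lessThan_telescope[of w] by (intro convergent_add convergent_const)
  then show ?thesis by simp
qed

lemma (in finite_measure) AE_eventually_of_measure_le:
  assumes "\<And>n. A n \<in> sets M" "\<And>n. measure M (A n) \<le> c * (1/2) ^ n"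
  shows "AE x in M. \<forall>\<^sub>F n in sequentially. x \<notin> A n"
proof -
  have "summable (\<lambda>n. measure M (A n))"
    by (rule summable_comparison_test'[of "\<lambda>n. c * (1/2) ^ n"])
      (use assms in \<open>auto intro!: summable_mult summable_geometric\<close>)
  then have "AE x in M. \<forall>\<^sub>F n in sequentially. x \<in> space M - A n"
    using assms(1) by (intro borel_cantelli_AE1) (auto simp: less_top[symmetric])
  then show ?thesis by eventually_elim (auto elim: eventually_mono)
qed

text \<open>The sets on which some later approximant is still off by \<open>\<epsilon>\<close>
  decrease to the empty set; finiteness of the measure makes their measures tend to
  \<open>0\<close>.\<close>

lemma (in finite_measure) simple_limit_approx_in_measure:
  fixes w :: "'a \<Rightarrow> 'b::real_normed_vector"
  assumes "simple_limit M w" "0 < \<epsilon>" "0 < \<eta>"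
  obtains s where "simple_function M s" "measure M {x\<in>space M. \<epsilon> \<le> norm (s x - w x)} \<le> \<eta>"
proof -
  obtain t where t: "\<And>n::nat. simple_function M (t n)" "\<And>x. x \<in> space M \<Longrightarrow> (\<lambda>n. t n x) \<longlonglongrightarrow> w x"
    using assms(1) unfolding simple_limit_def by blast
  have [measurable]: "(\<lambda>x. norm (t n x - w x)) \<in> borel_measurable M" for n
    using simple_limit_borel_measurable[OF simple_limit_diff[OF simple_limit_simple[OF t(1)] assms(1)]]
    by measurable
  define A where "A n = (\<Union>m\<in>{n..}. {x\<in>space M. \<epsilon> \<le> norm (t m x - w x)})" for n
  have Am: "A n \<in> sets M" for n unfolding A_def by measurable
  have "decseq A"
    unfolding decseq_def A_def by (intro allI impI UN_mono) auto
  then have "(\<lambda>n. measure M (A n)) \<longlonglongrightarrow> measure M (\<Inter>n. A n)"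
    using Am by (intro finite_Lim_measure_decseq) auto
  also have "(\<Inter>n. A n) = {}"
  proof -
    have False if "x \<in> (\<Inter>n. A n)" for x
    proof -
      have x: "x \<in> space M" using that unfolding A_def by auto
      obtain N where "\<And>n. N \<le> n \<Longrightarrow> norm (t n x - w x) < \<epsilon>"
        using LIMSEQ_D[OF t(2)[OF x] assms(2)] by blast
      moreover have "x \<in> A N" using that by blast
      ultimately show False unfolding A_def by fastforce
    qed
    then show ?thesis by blast
  qed
  finally have "\<forall>\<^sub>F n in sequentially. measure M (A n) < \<eta>"
    using assms(3) by (intro order_tendstoD(2)) auto
  then obtain n where n: "measure M (A n) < \<eta>" by (auto simp: eventually_sequentially)
  have "measure M {x\<in>space M. \<epsilon> \<le> norm (t n x - w x)} \<le> measure M (A n)"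
    using Am by (intro finite_measure_mono) (auto simp: A_def)
  then show thesis using that[OF t(1)[of n]] n by simp
qed

text \<open>A diagonal choice: a simple function within \<open>(1/2) ^ n\<close> of
  \<open>w n\<close> off a set of measure at most \<open>(1/2) ^ n\<close>. By Borel-Cantelli almost
  every point meets only finitely many of these sets.\<close>

lemma (in finite_measure) strongly_measurable_AE_limit:
  fixes w :: "nat \<Rightarrow> 'a \<Rightarrow> 'b::real_normed_vector"
  assumes w: "\<And>n. simple_limit M (w n)" and lim: "AE x in M. (\<lambda>n. w n x) \<longlonglongrightarrow> v x"
  shows "strongly_measurable M v"
proof -
  have "\<exists>s. simple_function M s \<and> measure M {x\<in>space M. (1/2) ^ n \<le> norm (s x - w n x)} \<le> (1/2) ^ n" for n
    by (rule simple_limit_approx_in_measure[OF w[of n], of "(1/2) ^ n" "(1/2) ^ n"]) auto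
  then obtain s where s: "\<And>n. simple_function M (s n)"
    "\<And>n. measure M {x\<in>space M. (1/2) ^ n \<le> norm (s n x - w n x)} \<le> (1/2) ^ n" by metis
  have [measurable]: "(\<lambda>x. norm (s n x - w n x)) \<in> borel_measurable M" for n
    using simple_limit_borel_measurable[OF simple_limit_diff[OF simple_limit_simple[OF s(1)] w]]
    by measurable
  have "AE x in M. \<forall>\<^sub>F n in sequentially. x \<notin> {x\<in>space M. (1/2) ^ n \<le> norm (s n x - w n x)}"
    by (rule AE_eventually_of_measure_le[where c=1]) (use s(2) in auto)
  then have "AE x in M. (\<lambda>n. s n x) \<longlonglongrightarrow> v x"
    using lim AE_space
  proof eventually_elim
    case (elim x)
    then have "\<forall>\<^sub>F n in sequentially. norm (s n x - w n x) \<le> (1/2) ^ n"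
      by (auto elim!: eventually_mono)
    then have "(\<lambda>n. s n x - w n x) \<longlonglongrightarrow> 0"
      by (rule Lim_null_comparison) (simp add: LIMSEQ_power_zero)
    from tendsto_add[OF this elim(2)] show ?case by simp
  qed
  then show ?thesis using s(1) unfolding strongly_measurable_def by blast
qed

subsection \<open>Functionals on normed spaces and uniform convexity\<close>

interpretation normed: real_linear_space "scaleR :: real \<Rightarrow> 'e::real_normed_vector \<Rightarrow> 'e"
  by unfold_locales (auto simp: algebra_simps)

lemma norming_bounded_linear:
  fixes y :: "'e::real_normed_vector"
  obtains \<phi> where "bounded_linear \<phi>" "\<And>v. \<bar>\<phi> v\<bar> \<le> norm v" "\<phi> y = norm y"
proof (rule normed.norming_linear_form[of UNIV norm y])
  show "normed.seminorm_on UNIV (norm :: 'e \<Rightarrow> real)"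
    unfolding normed.seminorm_on_def by (auto intro: norm_triangle_ineq)
  fix \<phi> :: "'e \<Rightarrow> real"
  assume \<phi>: "normed.linear_form_on UNIV \<phi>" "\<And>v. v \<in> UNIV \<Longrightarrow> \<bar>\<phi> v\<bar> \<le> norm v" "\<phi> y = norm y"
  have "bounded_linear \<phi>"
    by (rule bounded_linear_intro[of _ 1]) (use \<phi> in \<open>auto simp: normed.linear_form_on_def\<close>)
  then show thesis using that \<phi> by blast
qed (auto simp: module.subspace_UNIV[OF real_vector.module_axioms])

lemma eq_if_bounded_linear_eq:
  fixes x y :: "'e::real_normed_vector"
  assumes "\<And>\<phi> :: 'e \<Rightarrow> real. bounded_linear \<phi> \<Longrightarrow> \<phi> x = \<phi> y"
  shows "x = y"
proof -
  obtain \<phi> where \<phi>: "bounded_linear \<phi>" "\<phi> (x - y) = norm (x - y)"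
    using norming_bounded_linear[of "x - y"] by metis
  then have "norm (x - y) = 0"
    using assms[OF \<phi>(1)] linear_diff[OF bounded_linear.linear[OF \<phi>(1)]] by simp
  then show ?thesis by simp
qed

lemma tendsto_imp_weak_conv: "u \<longlonglongrightarrow> l \<Longrightarrow> weak_conv u l"
  unfolding weak_conv_def using bounded_linear.tendsto by blast

lemma weak_conv_norm_le:
  assumes "weak_conv u l" "\<And>n. norm (u n) \<le> C"
  shows "norm l \<le> C"
proof -
  obtain \<phi> where \<phi>: "bounded_linear \<phi>" "\<And>v. \<bar>\<phi> v\<bar> \<le> norm v" "\<phi> l = norm l"
    using norming_bounded_linear[of l] by metis
  have "(\<lambda>n. \<phi> (u n)) \<longlonglongrightarrow> norm l" using assms(1) \<phi> unfolding weak_conv_def by metis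
  moreover have "\<phi> (u n) \<le> C" for n using \<phi>(2)[of "u n"] assms(2)[of n] by linarith
  ultimately show ?thesis by (intro LIMSEQ_le_const2) auto
qed

text \<open>Uniform convexity speaks of the unit sphere, whereas the minimisation needs a gain for
  squared norms on the whole unit ball. If the norms differ noticeably, the gain comes from strict
  convexity of the real square; otherwise the normalised vectors are still apart on the
  sphere.\<close>

lemma uniformly_convex_square:
  assumes uc: "uniformly_convex TYPE('e::real_normed_vector)" and eps: "0 < \<epsilon>"
  shows "\<exists>\<delta>>0. \<forall>a b :: 'e. norm a \<le> 1 \<and> norm b \<le> 1 \<and> \<epsilon> \<le> norm (a - b) \<longrightarrow>
    (norm ((1/2) *\<^sub>R (a + b)))\<^sup>2 \<le> ((norm a)\<^sup>2 + (norm b)\<^sup>2) / 2 - \<delta>"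
proof -
  \<comment> \<open>The modulus of convexity is only given up to \<open>2\<close>, the diameter of
    the sphere.\<close>
  define e where "e = min \<epsilon> 2"
  have e: "0 < e" "e \<le> \<epsilon>" "e \<le> 2" using eps by (auto simp: e_def)
  obtain d where d: "0 < d" "\<And>x y :: 'e. norm x = 1 \<Longrightarrow> norm y = 1 \<Longrightarrow> e / 2 \<le> norm (x - y) \<Longrightarrow>
      norm ((1/2) *\<^sub>R (x + y)) \<le> 1 - d"
    using uc[unfolded uniformly_convex_def, rule_format, of "e / 2"] e by auto
  \<comment> \<open>The first term is the gain \<open>(s - r)\<^sup>2 / 4\<close> for
    \<open>s - r \<ge> e / 4\<close>, the second is the gain \<open>r\<^sup>2 * d\<close> in the
    other case, where \<open>r > e / 4\<close>.\<close>
  define \<delta> where "\<delta> = min ((e/4)\<^sup>2 / 4) ((e/4)\<^sup>2 * d)"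
  have \<delta>: "0 < \<delta>" using e d by (simp add: \<delta>_def)
  have main: "(norm ((1/2) *\<^sub>R (a + b)))\<^sup>2 \<le> ((norm a)\<^sup>2 + (norm b)\<^sup>2) / 2 - \<delta>"
    if ab: "norm a \<le> 1" "norm b \<le> norm a" "\<epsilon> \<le> norm (a - b)" for a b :: 'e
  proof -
    define s r where "s = norm a" and "r = norm b"
    have sr: "0 \<le> r" "r \<le> s" "s \<le> 1" using ab by (auto simp: s_def r_def)
    have par: "((s + r) / 2)\<^sup>2 = (s\<^sup>2 + r\<^sup>2) / 2 - (s - r)\<^sup>2 / 4"
      by (simp add: power2_eq_square field_simps)
    have mid: "norm ((1/2) *\<^sub>R (a + b)) \<le> (s + r) / 2"
      using norm_triangle_ineq[of a b] by (simp add: s_def r_def)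
    show ?thesis
    proof (cases "e / 4 \<le> s - r")
      case True
      have "(norm ((1/2) *\<^sub>R (a + b)))\<^sup>2 \<le> ((s + r) / 2)\<^sup>2"
        using mid by (intro power_mono) auto
      moreover have "(e/4)\<^sup>2 \<le> (s - r)\<^sup>2" using True e by (intro power_mono) auto
      moreover have "\<delta> \<le> (e/4)\<^sup>2 / 4" by (simp add: \<delta>_def)
      ultimately show ?thesis using par unfolding s_def r_def by linarith
    next
      case False
      have "e \<le> s + r" using ab(3) norm_triangle_ineq4[of a b] e by (simp add: s_def r_def)
      then have re: "e / 4 < r" using False e by linarith
      have pos: "0 < r" "0 < s" using re e sr by auto
      define x y where "x = (1/s) *\<^sub>R a" and "y = (1/r) *\<^sub>R b"
      have axy: "a = s *\<^sub>R x" "b = r *\<^sub>R y" using pos by (auto simp: x_def y_def)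
      have nxy: "norm x = 1" "norm y = 1" using pos by (auto simp: x_def y_def s_def r_def)
      have "a - b = s *\<^sub>R (x - y) + (s - r) *\<^sub>R y"
        unfolding axy by (simp add: algebra_simps)
      then have "norm (a - b) \<le> s * norm (x - y) + (s - r)"
        using norm_triangle_ineq[of "s *\<^sub>R (x - y)" "(s - r) *\<^sub>R y"] sr nxy by simp
      also have "\<dots> \<le> norm (x - y) + e / 4"
        using False sr mult_right_mono[of s 1 "norm (x - y)"] by simp
      finally have "e / 2 \<le> norm (x - y)" using ab(3) e by linarith
      from d(2)[OF nxy this] have dxy: "norm ((1/2) *\<^sub>R (x + y)) \<le> 1 - d" .
      have d1: "d \<le> 1" using dxy norm_ge_zero[of "(1/2) *\<^sub>R (x + y)"] by linarith
      \<comment> \<open>Both vectors are cut to the shorter length \<open>r\<close>, where the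
        sphere estimate applies after scaling; the excess \<open>s - r\<close> of the longer one is
        paid by the triangle inequality.\<close>
      have "(1/2) *\<^sub>R (a + b) = r *\<^sub>R ((1/2) *\<^sub>R (x + y)) + ((s - r) / 2) *\<^sub>R x"
        unfolding axy by (simp add: algebra_simps add_divide_distrib diff_divide_distrib)
      then have "norm ((1/2) *\<^sub>R (a + b)) \<le> r * norm ((1/2) *\<^sub>R (x + y)) + (s - r) / 2"
        using norm_triangle_ineq[of "r *\<^sub>R ((1/2) *\<^sub>R (x + y))" "((s - r) / 2) *\<^sub>R x"] sr nxy
        by simp
      also have "\<dots> \<le> r * (1 - d) + (s - r) / 2"
        using dxy sr by (intro add_right_mono mult_left_mono) auto
      also have "\<dots> = (s + r) / 2 - r * d" by (simp add: field_simps)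
      finally have "(norm ((1/2) *\<^sub>R (a + b)))\<^sup>2 \<le> ((s + r) / 2 - r * d)\<^sup>2"
        by (intro power_mono) auto
      also have "\<dots> \<le> ((s + r) / 2)\<^sup>2 - r\<^sup>2 * d"
      proof -
        define m where "m = (s + r) / 2"
        have m: "r \<le> m" using sr by (simp add: m_def)
        have rd: "0 \<le> r * d" "r * d \<le> r" using d d1 sr by (auto intro: mult_left_le)
        have "(r * d) * (r * d) \<le> (r * d) * m" using m rd by (intro mult_left_mono) auto
        moreover have "(r * d) * r \<le> (r * d) * m" using m rd by (intro mult_left_mono) auto
        ultimately have "(m - r * d)\<^sup>2 \<le> m\<^sup>2 - r\<^sup>2 * d"
          by (simp add: power2_eq_square algebra_simps)
        then show ?thesis by (simp add: m_def)
      qed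
      also have "\<dots> \<le> (s\<^sup>2 + r\<^sup>2) / 2 - r\<^sup>2 * d" using par by simp
      also have "(e/4)\<^sup>2 * d \<le> r\<^sup>2 * d"
        using re e d by (intro mult_right_mono power_mono) auto
      then have "(s\<^sup>2 + r\<^sup>2) / 2 - r\<^sup>2 * d \<le> (s\<^sup>2 + r\<^sup>2) / 2 - \<delta>" by (simp add: \<delta>_def)
      finally show ?thesis by (simp add: s_def r_def)
    qed
  qed
  show ?thesis
  proof (intro exI[of _ \<delta>] conjI allI impI \<delta>)
    fix a b :: 'e assume ab: "norm a \<le> 1 \<and> norm b \<le> 1 \<and> \<epsilon> \<le> norm (a - b)"
    show "(norm ((1/2) *\<^sub>R (a + b)))\<^sup>2 \<le> ((norm a)\<^sup>2 + (norm b)\<^sup>2) / 2 - \<delta>"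
    proof (cases "norm b \<le> norm a")
      case True
      then show ?thesis using main ab by blast
    next
      case False
      then show ?thesis
        using main[of b a] ab by (simp add: add.commute norm_minus_commute)
    qed
  qed
qed

text \<open>The functions \<open>w n\<close> almost minimise \<open>\<integral>\<parallel>w\<parallel>\<^sup>2\<close> over \<open>K n\<close>; uniform convexity makes them Cauchy
  in measure.\<close>

lemma (in finite_measure) uniformly_convex_AE_convergent:
  fixes K :: "nat \<Rightarrow> ('a \<Rightarrow> 'e::banach) set"
  assumes uc: "uniformly_convex TYPE('e)"
    and ne: "\<And>n. K n \<noteq> {}" and dec: "decseq K"
    and sl: "\<And>n w. w \<in> K n \<Longrightarrow> simple_limit M w"
    and le1: "\<And>n w x. w \<in> K n \<Longrightarrow> norm (w x) \<le> 1"
    and mid: "\<And>n u w. u \<in> K n \<Longrightarrow> w \<in> K n \<Longrightarrow> (\<lambda>x. (1/2) *\<^sub>R (u x + w x)) \<in> K n"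
  obtains w where "\<And>n. w n \<in> K n" "AE x in M. convergent (\<lambda>n. w n x)"
proof -
  define J where "J u = (\<integral>x. (norm (u x))\<^sup>2 \<partial>M)" for u :: "'a \<Rightarrow> 'e"
  have meas: "u \<in> borel_measurable M" if "u \<in> K n" for u n
    using simple_limit_borel_measurable[OF sl[OF that]] .
  have int: "integrable M (\<lambda>x. (norm (u x))\<^sup>2)" if "u \<in> K n" for u n
  proof (rule integrable_const_bound[of _ 1])
    show "AE x in M. norm ((norm (u x))\<^sup>2) \<le> 1"
      using le1[OF that] by (simp add: abs_square_le_1)
    show "(\<lambda>x. (norm (u x))\<^sup>2) \<in> borel_measurable M" using meas[OF that] by measurable
  qed
  have J0: "0 \<le> J u" for u unfolding J_def by simp
  have J1: "J u \<le> measure M (space M)" if "u \<in> K n" for u n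
  proof -
    have "J u \<le> (\<integral>x. 1 \<partial>M)"
      unfolding J_def using le1[OF that] int[OF that]
      by (intro integral_mono) (auto simp: abs_square_le_1)
    then show ?thesis by simp
  qed
  define d where "d n = Inf (J ` K n)" for n
  have bdd: "bdd_below (J ` K n)" for n using J0 by (intro bdd_belowI2[of _ 0]) auto
  have d_le: "d n \<le> J u" if "u \<in> K n" for u n
    unfolding d_def using bdd that by (intro cInf_lower) auto
  have d_bound: "d n \<le> measure M (space M)" for n
    using ne[of n] d_le J1 by (metis all_not_in_conv order_trans)
  have bdda: "bdd_above (range d)" using d_bound by (intro bdd_aboveI2)
  \<comment> \<open>As \<open>K\<close> shrinks, the infima \<open>d n\<close> increase, but stay
    below the total mass. Near their supremum \<open>D\<close>, passing to a smaller set can no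
    longer raise the infimum by much.\<close>
  define D where "D = (SUP n. d n)"
  have dD: "d n \<le> D" for n unfolding D_def using bdda by (intro cSUP_upper) auto
  have d_mono: "d m \<le> d n" if "m \<le> n" for m n
    unfolding d_def using decseqD[OF dec that] ne bdd by (intro cInf_superset_mono) auto
  have "\<exists>\<delta>>0. \<forall>a b :: 'e. norm a \<le> 1 \<and> norm b \<le> 1 \<and> (1/2) ^ j \<le> norm (a - b) \<longrightarrow>
      (norm ((1/2) *\<^sub>R (a + b)))\<^sup>2 \<le> ((norm a)\<^sup>2 + (norm b)\<^sup>2) / 2 - \<delta>" for j :: nat
    by (rule uniformly_convex_square[OF uc]) simp
  then obtain \<delta> where \<delta>: "\<And>j::nat. 0 < \<delta> j" "\<And>j a b. norm (a::'e) \<le> 1 \<Longrightarrow> norm b \<le> 1 \<Longrightarrow>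
      (1/2) ^ j \<le> norm (a - b) \<Longrightarrow>
      (norm ((1/2) *\<^sub>R (a + b)))\<^sup>2 \<le> ((norm a)\<^sup>2 + (norm b)\<^sup>2) / 2 - \<delta> j" by metis
  \<comment> \<open>An averaging defect of at most \<open>2 * \<eta> j\<close> together with the
    gain \<open>\<delta> j\<close> on \<open>A j\<close> forces
    \<open>measure M (A j) \<le> 2 * (1/2) ^ j\<close>, which is summable.\<close>
  define \<eta> where "\<eta> j = \<delta> j * (1/2) ^ j" for j
  have \<eta>0: "0 < \<eta> j" for j using \<delta>(1) by (simp add: \<eta>_def)
  have "\<exists>k. D - \<eta> j < d k" for j
    using less_cSUP_iff[of UNIV d "D - \<eta> j"] bdda \<eta>0[of j] unfolding D_def by auto
  then obtain \<kappa> where \<kappa>: "\<And>j. D - \<eta> j < d (\<kappa> j)" by metis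
  \<comment> \<open>The sum is merely a monotone index that dominates both \<open>j\<close> and
    \<open>\<kappa> j\<close>.\<close>
  define i where "i j = j + (\<Sum>l\<le>j. \<kappa> l)" for j
  have i_ge: "j \<le> i j" "\<kappa> j \<le> i j" for j
    unfolding i_def by (auto intro!: trans_le_add2 member_le_sum)
  have i_Suc: "i j \<le> i (Suc j)" for j unfolding i_def by simp
  \<comment> \<open>The minimum over all earlier tolerances makes \<open>w (Suc j)\<close> good
    enough for comparison at level \<open>j\<close> as well.\<close>
  define \<eta>' where "\<eta>' j = Min (\<eta> ` {..j})" for j
  have \<eta>': "0 < \<eta>' j" "\<eta>' j \<le> \<eta> j" "\<eta>' (Suc j) \<le> \<eta> j" for j
    unfolding \<eta>'_def using \<eta>0 by auto
  have "\<exists>u\<in>K (i j). J u < d (i j) + \<eta>' j" for j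
  proof -
    have "\<exists>y\<in>J ` K (i j). y < d (i j) + \<eta>' j"
      unfolding d_def using ne \<eta>'(1)[of j] bdd by (intro cInf_lessD) auto
    then show ?thesis by blast
  qed
  then obtain w where w: "\<And>j. w j \<in> K (i j)" "\<And>j. J (w j) < d (i j) + \<eta>' j" by metis
  define A where "A j = {x\<in>space M. (1/2) ^ j \<le> norm (w j x - w (Suc j) x)}" for j
  have wi: "w (Suc j) \<in> K (i j)" for j
    using w(1)[of "Suc j"] decseqD[OF dec i_Suc[of j]] by blast
  have [measurable]: "(\<lambda>x. norm (w j x - w (Suc j) x)) \<in> borel_measurable M" for j
    using simple_limit_borel_measurable[OF simple_limit_diff[OF sl[OF w(1)] sl[OF w(1)]]]
    by measurable
  have Am: "A j \<in> sets M" for j unfolding A_def by measurable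
  have "measure M (A j) \<le> 2 * (1/2) ^ j" for j
  proof -
    let ?m = "\<lambda>x. (1/2) *\<^sub>R (w j x + w (Suc j) x)"
    have mK: "?m \<in> K (i j)" using mid[OF w(1) wi] .
    have intA: "integrable M (\<lambda>x. indicat_real (A j) x)"
      using Am by (intro integrable_real_indicator) (auto simp: less_top[symmetric])
    \<comment> \<open>The midpoint lies in \<open>K (i j)\<close>, so its energy is above
      \<open>D - \<eta> j\<close>, while both endpoints have energy below
      \<open>D + \<eta> j\<close>. Integrating the pointwise gain therefore limits the size of
      \<open>A j\<close>.\<close>
    have "J ?m \<le> (\<integral>x. ((norm (w j x))\<^sup>2 + (norm (w (Suc j) x))\<^sup>2) / 2 - \<delta> j * indicat_real (A j) x \<partial>M)"
      unfolding J_def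
    proof (rule integral_mono)
      show "integrable M (\<lambda>x. (norm (?m x))\<^sup>2)" using int[OF mK] .
      show "integrable M (\<lambda>x. ((norm (w j x))\<^sup>2 + (norm (w (Suc j) x))\<^sup>2) / 2 - \<delta> j * indicat_real (A j) x)"
        using int[OF w(1)] intA by (intro Bochner_Integration.integrable_diff integrable_divide
            Bochner_Integration.integrable_add integrable_mult_right) auto
      fix x assume x: "x \<in> space M"
      show "(norm (?m x))\<^sup>2 \<le> ((norm (w j x))\<^sup>2 + (norm (w (Suc j) x))\<^sup>2) / 2 - \<delta> j * indicat_real (A j) x"
      proof (cases "x \<in> A j")
        case True
        then have "(1/2) ^ j \<le> norm (w j x - w (Suc j) x)" by (simp add: A_def)
        from \<delta>(2)[OF le1[OF w(1)] le1[OF wi] this] show ?thesis using True by simp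
      next
        case False
        have "norm (?m x) \<le> (norm (w j x) + norm (w (Suc j) x)) / 2"
          using norm_triangle_ineq[of "w j x" "w (Suc j) x"] by simp
        then have "(norm (?m x))\<^sup>2 \<le> ((norm (w j x) + norm (w (Suc j) x)) / 2)\<^sup>2"
          by (intro power_mono) auto
        also have "\<dots> \<le> ((norm (w j x))\<^sup>2 + (norm (w (Suc j) x))\<^sup>2) / 2"
          using zero_le_power2[of "norm (w j x) - norm (w (Suc j) x)"]
          by (simp add: power2_eq_square field_simps)
        finally show ?thesis using False by simp
      qed
    qed
    also have "\<dots> = (J (w j) + J (w (Suc j))) / 2 - \<delta> j * measure M (A j)"
      unfolding J_def using int[OF w(1)] intA Am by (simp add: sets.Int_space_eq2)
    finally have "\<delta> j * measure M (A j) \<le> (J (w j) + J (w (Suc j))) / 2 - J ?m" by simp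
    also have "\<dots> \<le> (D + \<eta> j) - (D - \<eta> j)"
      using w(2)[of j] w(2)[of "Suc j"] dD[of "i j"] dD[of "i (Suc j)"] \<eta>'(2)[of j] \<eta>'(3)[of j]
        d_le[OF mK] \<kappa>[of j] d_mono[OF i_ge(2)[of j]] by argo
    also have "\<dots> = \<delta> j * (2 * (1/2) ^ j)" by (simp add: \<eta>_def)
    finally show ?thesis using \<delta>(1)[of j] by simp
  qed
  then have "AE x in M. \<forall>\<^sub>F j in sequentially. x \<notin> A j"
    using Am by (intro AE_eventually_of_measure_le)
  then have "AE x in M. convergent (\<lambda>n. w n x)"
    using AE_space
  proof eventually_elim
    case (elim x)
    then have "\<forall>\<^sub>F j in sequentially. norm (w (Suc j) x - w j x) \<le> (1/2) ^ j"
      by (auto simp: A_def norm_minus_commute elim!: eventually_mono)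
    then show ?case by (rule summable_dist_imp_convergent)
  qed
  moreover have "w n \<in> K n" for n
    using w(1)[of n] decseqD[OF dec i_ge(1)[of n]] by blast
  ultimately show thesis using that by blast
qed

text \<open>The sign \<open>\<sigma>\<close> is fixed along the subsequence so that the inequality
  is one-sided and hence stable under averages.\<close>

lemma not_tendsto_imp_subseq:
  fixes X :: "nat \<Rightarrow> real"
  assumes "\<not> X \<longlonglongrightarrow> L"
  obtains \<epsilon> \<sigma> r where "0 < \<epsilon>" "\<bar>\<sigma>\<bar> = 1" "strict_mono (r :: nat \<Rightarrow> nat)" "\<And>n. \<epsilon> \<le> \<sigma> * (X (r n) - L)"
proof -
  obtain \<epsilon> where \<epsilon>: "0 < \<epsilon>" "\<And>N. \<exists>n\<ge>N. \<epsilon> \<le> \<bar>X n - L\<bar>"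
    using assms unfolding LIMSEQ_def dist_real_def by (auto simp: not_less)
  have "infinite {n. \<epsilon> \<le> \<bar>X n - L\<bar>}"
    using \<epsilon>(2) by (simp add: infinite_nat_iff_unbounded_le)
  moreover have "{n. \<epsilon> \<le> \<bar>X n - L\<bar>} = {n. \<epsilon> \<le> 1 * (X n - L)} \<union> {n. \<epsilon> \<le> (-1) * (X n - L)}"
    by auto
  ultimately have "infinite {n. \<epsilon> \<le> 1 * (X n - L)} \<or> infinite {n. \<epsilon> \<le> (-1) * (X n - L)}"
    by (simp only: finite_Un de_Morgan_conj)
  then have "\<exists>\<sigma>\<in>{1, -1}. infinite {n. \<epsilon> \<le> \<sigma> * (X n - L)}" by simp
  then obtain \<sigma> where \<sigma>: "\<sigma> \<in> {1, -1}" "infinite {n. \<epsilon> \<le> \<sigma> * (X n - L)}" ..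
  have "\<bar>\<sigma>\<bar> = 1" using \<sigma>(1) by auto
  obtain r where "strict_mono (r :: nat \<Rightarrow> nat)" "\<And>n. r n \<in> {n. \<epsilon> \<le> \<sigma> * (X n - L)}"
    using infinite_enumerate[OF \<sigma>(2)] by blast
  then show thesis using that[OF \<epsilon>(1) \<open>\<bar>\<sigma>\<bar> = 1\<close>] by blast
qed

text \<open>The averages \<open>w n\<close> keep every midpoint-stable property \<open>P\<close> of
  the given functions and converge in norm almost everywhere. The last conclusion identifies the
  limit through each functional that converges along the original sequence at that point.\<close>

lemma (in finite_measure) uniformly_convex_weak_limit:
  fixes v :: "nat \<Rightarrow> 'a \<Rightarrow> 'e::banach"
  assumes uc: "uniformly_convex TYPE('e)" and C: "0 < C"
    and v: "\<And>n. simple_limit M (v n)" "\<And>n x. norm (v n x) \<le> C"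
    and P: "\<And>n. P (v n)" "\<And>u w. P u \<Longrightarrow> P w \<Longrightarrow> P (\<lambda>x. (1/2) *\<^sub>R (u x + w x))"
  obtains w l where "\<And>n. P (w n)" "\<And>n. simple_limit M (w n)" "\<And>n x. norm (w n x) \<le> C"
    "AE x in M. (\<lambda>n. w n x) \<longlonglongrightarrow> l x"
    "\<And>x \<phi> c. (\<lambda>n. w n x) \<longlonglongrightarrow> l x \<Longrightarrow> bounded_linear \<phi> \<Longrightarrow> (\<lambda>n. \<phi> (v n x)) \<longlonglongrightarrow> c \<Longrightarrow> \<phi> (l x) = (c::real)"
proof -
  \<comment> \<open>The last condition places \<open>C *\<^sub>R w x\<close> in every closed
    half-space containing the tail \<open>v m x\<close>, \<open>m \<ge> n\<close>. This encodes the
    closed convex hull at each point and is visibly stable under midpoints.\<close>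
  define K where "K n = {w. simple_limit M w \<and> (\<forall>x. norm (w x) \<le> 1) \<and> P (\<lambda>x. C *\<^sub>R w x) \<and>
    (\<forall>x \<phi> c. bounded_linear \<phi> \<longrightarrow> (\<forall>m\<ge>n. \<phi> (v m x) \<le> c) \<longrightarrow> \<phi> (C *\<^sub>R w x) \<le> (c::real))}" for n
  have ne: "(\<lambda>x. (1/C) *\<^sub>R v n x) \<in> K n" for n
    unfolding K_def using C v P simple_limit_scaleR[OF simple_limit_const v(1), of "1/C"]
    by (auto simp: field_simps)
  have dec: "decseq K" unfolding decseq_def K_def by (auto dest: order_trans)
  have mid: "(\<lambda>x. (1/2) *\<^sub>R (u x + w x)) \<in> K n" if "u \<in> K n" "w \<in> K n" for u w n
    unfolding K_def
  proof (intro CollectI conjI allI impI)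
    show "simple_limit M (\<lambda>x. (1/2) *\<^sub>R (u x + w x))"
      using that by (intro simple_limit_scaleR simple_limit_const simple_limit_add) (auto simp: K_def)
    show "norm ((1/2) *\<^sub>R (u x + w x)) \<le> 1" for x
    proof -
      have "norm (u x) \<le> 1" "norm (w x) \<le> 1" using that by (auto simp: K_def)
      then show ?thesis using norm_triangle_ineq[of "u x" "w x"] by simp
    qed
    have "P (\<lambda>x. (1/2) *\<^sub>R (C *\<^sub>R u x + C *\<^sub>R w x))" using that by (intro P) (auto simp: K_def)
    then show "P (\<lambda>x. C *\<^sub>R ((1/2) *\<^sub>R (u x + w x)))" by (simp add: algebra_simps)
    fix x c and \<phi> :: "'e \<Rightarrow> real" assume \<phi>: "bounded_linear \<phi>" "\<forall>m\<ge>n. \<phi> (v m x) \<le> c"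
    then have "\<phi> (C *\<^sub>R u x) \<le> c" "\<phi> (C *\<^sub>R w x) \<le> c" using that by (auto simp: K_def)
    then show "\<phi> (C *\<^sub>R ((1/2) *\<^sub>R (u x + w x))) \<le> c"
      using \<phi>(1) by (simp add: linear_add linear_scale bounded_linear.linear algebra_simps)
  qed
  obtain y where y: "\<And>n. y n \<in> K n" "AE x in M. convergent (\<lambda>n. y n x)"
  proof (rule uniformly_convex_AE_convergent[OF uc, of K])
    show "K n \<noteq> {}" for n using ne[of n] by blast
  qed (use dec mid in \<open>auto simp: K_def\<close>)
  define w where "w n x = C *\<^sub>R y n x" for n x
  define l where "l x = lim (\<lambda>n. w n x)" for x
  have w: "P (w n)" "simple_limit M (w n)" "norm (w n x) \<le> C" for n x
    using y(1)[of n] C simple_limit_scaleR[OF simple_limit_const, of M "y n" C]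
    by (auto simp: w_def[abs_def] K_def)
  have hull: "\<phi> (w n x) \<le> c" if "bounded_linear \<phi>" "\<And>m. n \<le> m \<Longrightarrow> \<phi> (v m x) \<le> c"
    for \<phi> and c :: real and n x
    using y(1)[of n] that by (auto simp: w_def K_def)
  have wl: "AE x in M. (\<lambda>n. w n x) \<longlonglongrightarrow> l x"
    using y(2)
  proof eventually_elim
    case (elim x)
    then have "convergent (\<lambda>n. w n x)"
      unfolding w_def convergent_def by (auto intro: tendsto_scaleR[OF tendsto_const])
    then show ?case unfolding l_def by (simp add: convergent_LIMSEQ_iff)
  qed
  \<comment> \<open>Only upper bounds pass through the half-spaces; the reverse inequality is this
    one for \<open>- \<phi>\<close>.\<close>
  have le: "\<phi> (l x) \<le> c"
    if lim: "(\<lambda>n. w n x) \<longlonglongrightarrow> l x" and \<phi>: "bounded_linear \<phi>" "(\<lambda>n. \<phi> (v n x)) \<longlonglongrightarrow> c"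
    for x \<phi> and c :: real
  proof (rule field_le_epsilon)
    fix \<eta> :: real assume "0 < \<eta>"
    then have "\<forall>\<^sub>F n in sequentially. \<phi> (v n x) < c + \<eta>" using \<phi>(2) by (intro order_tendstoD(2)) auto
    then obtain N where "\<And>n. N \<le> n \<Longrightarrow> \<phi> (v n x) < c + \<eta>" by (auto simp: eventually_sequentially)
    then have "\<phi> (w n x) \<le> c + \<eta>" if "N \<le> n" for n
      using that by (intro hull[OF \<phi>(1)]) (meson less_imp_le order_trans)
    moreover have "(\<lambda>n. \<phi> (w n x)) \<longlonglongrightarrow> \<phi> (l x)" using bounded_linear.tendsto[OF \<phi>(1) lim] .
    ultimately show "\<phi> (l x) \<le> c + \<eta>" by (intro LIMSEQ_le_const2) auto
  qed
  have eq: "\<phi> (l x) = c"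
    if lim: "(\<lambda>n. w n x) \<longlonglongrightarrow> l x" and \<phi>: "bounded_linear \<phi>" "(\<lambda>n. \<phi> (v n x)) \<longlonglongrightarrow> c"
    for x \<phi> and c :: real
    using le[OF lim \<phi>] le[OF lim bounded_linear_minus[OF \<phi>(1)] tendsto_minus[OF \<phi>(2)]] by simp
  show thesis by (rule that[of w l]) (fact w wl eq)+
qed

text \<open>If some \<open>\<psi>\<close> stayed away from \<open>0\<close> along a subsequence,
  averages of it would converge in norm to a point of \<open>closure S\<close> annihilated by all
  \<open>\<phi> y\<close> with \<open>y \<in> S\<close>. Such a point is \<open>0\<close>, which
  contradicts the bound for \<open>\<psi>\<close>.\<close>

lemma weak_conv_zeroI:
  fixes z :: "nat \<Rightarrow> 'e::banach"
  assumes uc: "uniformly_convex TYPE('e)" and bdd: "\<And>n. norm (z n) \<le> C"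
    and S: "\<And>n. z n \<in> closure S" "\<And>x y. x \<in> closure S \<Longrightarrow> y \<in> closure S \<Longrightarrow> (1/2) *\<^sub>R (x + y) \<in> closure S"
    and \<phi>: "\<And>y. bounded_linear (\<phi> y)" "\<And>y v. \<bar>\<phi> y v\<bar> \<le> norm v" "\<And>y. \<phi> y y = norm y"
    and lim: "\<And>y. y \<in> S \<Longrightarrow> (\<lambda>n. \<phi> y (z n)) \<longlonglongrightarrow> 0"
  shows "weak_conv z 0"
  unfolding weak_conv_def
proof (intro allI impI)
  fix \<psi> :: "'e \<Rightarrow> real" assume \<psi>: "bounded_linear \<psi>"
  have \<psi>0: "\<psi> 0 = 0" using \<psi> by (simp add: linear_0 bounded_linear.linear)
  show "(\<lambda>n. \<psi> (z n)) \<longlonglongrightarrow> \<psi> 0"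
  proof (rule ccontr)
    assume "\<not> ?thesis"
    then obtain \<epsilon> \<sigma> r where \<epsilon>: "0 < \<epsilon>" and r: "strict_mono (r :: nat \<Rightarrow> nat)"
      and ge: "\<And>n. \<epsilon> \<le> \<sigma> * (\<psi> (z (r n)) - \<psi> 0)"
      by (rule not_tendsto_imp_subseq) blast
    \<comment> \<open>On a one-point measure space the statement about functions becomes a statement
      about vectors of \<open>E\<close>.\<close>
    define M where "M = count_space (UNIV :: unit set)"
    interpret finite_measure M unfolding M_def by (rule finite_measure_count_space) simp
    define P where "P w \<longleftrightarrow> w () \<in> closure S \<and> \<epsilon> \<le> \<sigma> * \<psi> (w ())" for w :: "unit \<Rightarrow> 'e"
    have "0 \<le> C" using bdd[of 0] norm_ge_zero order_trans by blast
    obtain w l where w: "\<And>n. P (w n)" "AE x in M. (\<lambda>n. w n x) \<longlonglongrightarrow> l x"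
      "\<And>x \<phi> c. (\<lambda>n. w n x) \<longlonglongrightarrow> l x \<Longrightarrow> bounded_linear \<phi> \<Longrightarrow> (\<lambda>n. \<phi> (z (r n))) \<longlonglongrightarrow> c \<Longrightarrow> \<phi> (l x) = (c::real)"
    proof (rule uniformly_convex_weak_limit[OF uc, of "C + 1" "\<lambda>n _. z (r n)" P])
      show "norm (z (r n)) \<le> C + 1" for n using bdd[of "r n"] by simp
      show "simple_limit M (\<lambda>_. z (r n))" for n by (rule simple_limit_const)
      show "P (\<lambda>_. z (r n))" for n using S(1) ge[of n] \<psi>0 by (simp add: P_def)
      show "P (\<lambda>x. (1/2) *\<^sub>R (u x + w x))" if "P u" "P w" for u w
        using that S(2) \<psi> unfolding P_def
        by (auto simp: linear_add linear_scale bounded_linear.linear algebra_simps)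
    qed (use \<open>0 \<le> C\<close> in auto)
    have wl: "(\<lambda>n. w n ()) \<longlonglongrightarrow> l ()" using w(2) unfolding M_def AE_count_space by simp
    have lS: "l () \<in> closure S"
      using w(1) by (intro closed_sequentially[OF closed_closure _ wl]) (auto simp: P_def)
    \<comment> \<open>For \<open>y \<in> S\<close> near the limit, \<open>\<phi> y\<close> vanishes
      at the limit but norms \<open>y\<close>. Hence the norm of \<open>y\<close> is at most its
      distance to the limit, and the limit has arbitrarily small norm.\<close>
    have "norm (l ()) \<le> 0 + \<eta>" if "0 < \<eta>" for \<eta>
    proof -
      obtain y where y: "y \<in> S" "dist y (l ()) < \<eta> / 2"
        using lS \<open>0 < \<eta>\<close> unfolding closure_approachable by (meson half_gt_zero)
      have "\<phi> y (l ()) = 0"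
        using w(3)[OF wl \<phi>(1)] LIMSEQ_subseq_LIMSEQ[OF lim[OF y(1)] r] by (simp add: o_def)
      then have "norm y = \<phi> y (y - l ())"
        using \<phi>(1)[of y] \<phi>(3)[of y] by (simp add: linear_diff bounded_linear.linear)
      also have "\<dots> \<le> norm (y - l ())" using \<phi>(2)[of y "y - l ()"] by linarith
      finally show ?thesis
        using y(2) norm_triangle_ineq2[of "l ()" y] by (simp add: dist_norm norm_minus_commute)
    qed
    then have "norm (l ()) \<le> 0" by (rule field_le_epsilon)
    then have "l () = 0" by simp
    moreover have "(\<lambda>n. \<sigma> * \<psi> (w n ())) \<longlonglongrightarrow> \<sigma> * \<psi> (l ())"
      using bounded_linear.tendsto[OF \<psi> wl] by (intro tendsto_intros)
    then have "\<epsilon> \<le> \<sigma> * \<psi> (l ())"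
      using w(1) by (intro LIMSEQ_le_const) (auto simp: P_def)
    ultimately show False using \<epsilon> \<psi>0 by simp
  qed
qed

subsection \<open>The seminorm and the dual of \<open>L\<^sup>p\<close>\<close>

interpretation fun_space: real_linear_space "\<lambda>c (f :: 'a \<Rightarrow> 'e::real_normed_vector) x. c *\<^sub>R f x"
  by unfold_locales (auto simp: fun_eq_iff algebra_simps)

section \<open>Minkowski's inequality\<close>

lemma powr_convex_comb_le:
  fixes a b t p :: real
  assumes "1 \<le> p" "0 \<le> a" "0 \<le> b" "0 \<le> t" "t \<le> 1"
  shows "((1 - t) * a + t * b) powr p \<le> (1 - t) * a powr p + t * b powr p"
proof -
  have small: "(s * c) powr p \<le> s * c powr p" if "0 \<le> s" "s \<le> 1" "0 \<le> c" for s c :: real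
  proof (cases "s = 0")
    case False
    then have "s powr p \<le> s powr 1" using that assms(1) by (intro powr_mono') auto
    then show ?thesis using that by (simp add: powr_mult mult_right_mono)
  qed simp
  consider "a = 0" | "b = 0" | "0 < a" "0 < b" using assms by linarith
  then show ?thesis
  proof cases
    case 3
    then show ?thesis
      using convex_onD[OF powr_convex[OF assms(1)], of t a b] assms by simp
  qed (use small[of t b] small[of "1 - t" a] assms in auto)
qed

text \<open>Convexity applied to \<open>a / \<alpha>\<close> and \<open>b / \<beta>\<close> with
  weights proportional to \<open>\<alpha>\<close> and \<open>\<beta>\<close>. With integrals of at
  most \<open>\<alpha> powr p\<close> and \<open>\<beta> powr p\<close> the two coefficients add up
  to exactly \<open>(\<alpha> + \<beta>) powr p\<close>.\<close>

lemma powr_add_le: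
  fixes a b \<alpha> \<beta> p :: real
  assumes "1 \<le> p" "0 \<le> a" "0 \<le> b" "0 < \<alpha>" "0 < \<beta>"
  shows "(a + b) powr p \<le>
    (\<alpha> + \<beta>) powr p * (\<alpha> / (\<alpha> + \<beta>) / \<alpha> powr p) * a powr p + (\<alpha> + \<beta>) powr p * (\<beta> / (\<alpha> + \<beta>) / \<beta> powr p) * b powr p"
proof -
  define t where "t = \<beta> / (\<alpha> + \<beta>)"
  have t: "0 \<le> t" "t \<le> 1" "1 - t = \<alpha> / (\<alpha> + \<beta>)" using assms by (auto simp: t_def field_simps)
  have "(\<alpha> + \<beta>) * ((1 - t) * (a / \<alpha>) + t * (b / \<beta>)) = a + b"
  proof -
    have "(\<alpha> + \<beta>) * (\<alpha> / (\<alpha> + \<beta>) * (a / \<alpha>)) = a" "(\<alpha> + \<beta>) * (\<beta> / (\<alpha> + \<beta>) * (b / \<beta>)) = b"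
      using assms by simp_all
    then show ?thesis unfolding t(3) unfolding t_def distrib_left by simp
  qed
  then have "(a + b) powr p = (\<alpha> + \<beta>) powr p * ((1 - t) * (a / \<alpha>) + t * (b / \<beta>)) powr p"
    using assms t powr_mult[of "\<alpha> + \<beta>" "(1 - t) * (a / \<alpha>) + t * (b / \<beta>)" p] by simp
  also have "\<dots> \<le> (\<alpha> + \<beta>) powr p * ((1 - t) * (a / \<alpha>) powr p + t * (b / \<beta>) powr p)"
    using assms t by (intro mult_left_mono powr_convex_comb_le) auto
  also have "\<dots> = (\<alpha> + \<beta>) powr p * ((1 - t) / \<alpha> powr p) * a powr p + (\<alpha> + \<beta>) powr p * (t / \<beta> powr p) * b powr p"
    using assms by (simp add: powr_divide algebra_simps)
  finally show ?thesis unfolding t(3) unfolding t_def .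
qed

lemma Lp_cong_AE:
  assumes "u \<in> Lp M p" "AE x in M. u x = v x"
  shows "v \<in> Lp M p"
proof -
  have "(\<integral>\<^sup>+x. ennreal (norm (u x) powr p) \<partial>M) = (\<integral>\<^sup>+x. ennreal (norm (v x) powr p) \<partial>M)"
    by (rule nn_integral_cong_AE) (use assms(2) in eventually_elim, simp)
  then show ?thesis
    using assms strongly_measurable_cong_AE[of M u v] unfolding Lp_def by auto
qed

lemma Lp_norm_cong_AE:
  assumes "AE x in M. u x = v x"
  shows "Lp_norm M p u = Lp_norm M p v"
proof -
  have "(\<integral>\<^sup>+x. ennreal (norm (u x) powr p) \<partial>M) = (\<integral>\<^sup>+x. ennreal (norm (v x) powr p) \<partial>M)"
    by (rule nn_integral_cong_AE) (use assms in eventually_elim, simp)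
  then show ?thesis unfolding Lp_norm_def by simp
qed

lemma Lp_norm_le_iff:
  assumes "1 \<le> p" "u \<in> Lp M p" "0 \<le> \<alpha>"
  shows "Lp_norm M p u \<le> \<alpha> \<longleftrightarrow> (\<integral>\<^sup>+x. ennreal (norm (u x) powr p) \<partial>M) \<le> ennreal (\<alpha> powr p)"
proof -
  obtain e where e: "(\<integral>\<^sup>+x. ennreal (norm (u x) powr p) \<partial>M) = ennreal e" "0 \<le> e"
    using assms(2) unfolding Lp_def by (cases "\<integral>\<^sup>+x. ennreal (norm (u x) powr p) \<partial>M") auto
  have "e powr (1/p) \<le> \<alpha> \<longleftrightarrow> e \<le> \<alpha> powr p"
  proof
    assume "e powr (1/p) \<le> \<alpha>"
    then have "(e powr (1/p)) powr p \<le> \<alpha> powr p" using assms by (intro powr_mono2) auto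
    then show "e \<le> \<alpha> powr p" using assms e by (simp add: powr_powr)
  next
    assume "e \<le> \<alpha> powr p"
    then have "e powr (1/p) \<le> (\<alpha> powr p) powr (1/p)" using assms e by (intro powr_mono2) auto
    then show "e powr (1/p) \<le> \<alpha>" using assms by (simp add: powr_powr)
  qed
  then show ?thesis unfolding Lp_norm_def using e by simp
qed

lemma Lp_norm_nonneg: "0 \<le> Lp_norm M p u"
  unfolding Lp_norm_def by simp

lemma nn_integral_powr_add_le:
  assumes p: "1 \<le> p" and m: "strongly_measurable M u" "strongly_measurable M v" and pos: "0 < \<alpha>" "0 < \<beta>"
    and le: "(\<integral>\<^sup>+x. ennreal (norm (u x) powr p) \<partial>M) \<le> ennreal (\<alpha> powr p)"
      "(\<integral>\<^sup>+x. ennreal (norm (v x) powr p) \<partial>M) \<le> ennreal (\<beta> powr p)"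
  shows "(\<integral>\<^sup>+x. ennreal (norm (u x + v x) powr p) \<partial>M) \<le> ennreal ((\<alpha> + \<beta>) powr p)"
proof -
  obtain u' where u': "simple_limit M u'" "AE x in M. u x = u' x"
    using strongly_measurable_obtain_simple_limit[OF m(1)] by blast
  obtain v' where v': "simple_limit M v'" "AE x in M. v x = v' x"
    using strongly_measurable_obtain_simple_limit[OF m(2)] by blast
  have [measurable]: "u' \<in> borel_measurable M" "v' \<in> borel_measurable M"
    using u' v' simple_limit_borel_measurable by auto
  define c d where "c = (\<alpha> + \<beta>) powr p * (\<alpha> / (\<alpha> + \<beta>) / \<alpha> powr p)"
    and "d = (\<alpha> + \<beta>) powr p * (\<beta> / (\<alpha> + \<beta>) / \<beta> powr p)"
  have cd: "0 \<le> c" "0 \<le> d" using pos by (auto simp: c_def d_def)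
  have "(\<integral>\<^sup>+x. ennreal (norm (u x + v x) powr p) \<partial>M) \<le>
      (\<integral>\<^sup>+x. ennreal c * ennreal (norm (u' x) powr p) + ennreal d * ennreal (norm (v' x) powr p) \<partial>M)"
  proof (rule nn_integral_mono_AE)
    show "AE x in M. ennreal (norm (u x + v x) powr p) \<le>
        ennreal c * ennreal (norm (u' x) powr p) + ennreal d * ennreal (norm (v' x) powr p)"
      using u'(2) v'(2)
    proof eventually_elim
      case (elim x)
      have "norm (u x + v x) powr p \<le> (norm (u' x) + norm (v' x)) powr p"
        using elim p norm_triangle_ineq[of "u x" "v x"] by (intro powr_mono2) auto
      also have "\<dots> \<le> c * norm (u' x) powr p + d * norm (v' x) powr p"
        unfolding c_def d_def using p pos by (intro powr_add_le) auto
      finally show ?case using cd by (simp flip: ennreal_mult ennreal_plus)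
    qed
  qed
  also have "\<dots> = ennreal c * (\<integral>\<^sup>+x. ennreal (norm (u' x) powr p) \<partial>M) + ennreal d * (\<integral>\<^sup>+x. ennreal (norm (v' x) powr p) \<partial>M)"
    by (simp add: nn_integral_add nn_integral_cmult)
  also have "(\<integral>\<^sup>+x. ennreal (norm (u' x) powr p) \<partial>M) = (\<integral>\<^sup>+x. ennreal (norm (u x) powr p) \<partial>M)"
    by (rule nn_integral_cong_AE) (use u'(2) in eventually_elim, simp)
  also have "(\<integral>\<^sup>+x. ennreal (norm (v' x) powr p) \<partial>M) = (\<integral>\<^sup>+x. ennreal (norm (v x) powr p) \<partial>M)"
    by (rule nn_integral_cong_AE) (use v'(2) in eventually_elim, simp)
  also have "ennreal c * (\<integral>\<^sup>+x. ennreal (norm (u x) powr p) \<partial>M) + ennreal d * (\<integral>\<^sup>+x. ennreal (norm (v x) powr p) \<partial>M)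
     \<le> ennreal c * ennreal (\<alpha> powr p) + ennreal d * ennreal (\<beta> powr p)"
    using le by (intro add_mono mult_left_mono) auto
  also have "\<dots> = ennreal (c * \<alpha> powr p + d * \<beta> powr p)"
    using cd by (simp add: ennreal_mult ennreal_plus)
  also have "c * \<alpha> powr p + d * \<beta> powr p = (\<alpha> + \<beta>) powr p * (\<alpha> / (\<alpha> + \<beta>) + \<beta> / (\<alpha> + \<beta>))"
    unfolding c_def d_def using pos by (simp add: distrib_left)
  also have "\<alpha> / (\<alpha> + \<beta>) + \<beta> / (\<alpha> + \<beta>) = 1" using pos by (simp flip: add_divide_distrib)
  finally show ?thesis by simp
qed

lemma Lp_add_norm_le:
  assumes p: "1 \<le> p" and uv: "u \<in> Lp M p" "v \<in> Lp M p"
  shows "(\<lambda>x. u x + v x) \<in> Lp M p" "Lp_norm M p (\<lambda>x. u x + v x) \<le> Lp_norm M p u + Lp_norm M p v"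
proof -
  have m: "strongly_measurable M u" "strongly_measurable M v" using uv unfolding Lp_def by auto
  \<comment> \<open>The slack \<open>\<eta>\<close> makes both weights positive even where a
    seminorm vanishes.\<close>
  have key: "(\<integral>\<^sup>+x. ennreal (norm (u x + v x) powr p) \<partial>M) \<le> ennreal ((Lp_norm M p u + Lp_norm M p v + \<eta>) powr p)"
    if "0 < \<eta>" for \<eta>
  proof -
    have *: "Lp_norm M p u + \<eta> / 2 + (Lp_norm M p v + \<eta> / 2) = Lp_norm M p u + Lp_norm M p v + \<eta>" by simp
    have "(\<integral>\<^sup>+x. ennreal (norm (u x + v x) powr p) \<partial>M) \<le>
        ennreal ((Lp_norm M p u + \<eta> / 2 + (Lp_norm M p v + \<eta> / 2)) powr p)"
    proof (rule nn_integral_powr_add_le[OF p m])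
      have nn: "0 \<le> Lp_norm M p u + \<eta>/2" "0 \<le> Lp_norm M p v + \<eta>/2"
        using that Lp_norm_nonneg[of M p u] Lp_norm_nonneg[of M p v] by auto
      show "0 < Lp_norm M p u + \<eta>/2" "0 < Lp_norm M p v + \<eta>/2"
        using that Lp_norm_nonneg[of M p u] Lp_norm_nonneg[of M p v] by linarith+
      show "(\<integral>\<^sup>+x. ennreal (norm (u x) powr p) \<partial>M) \<le> ennreal ((Lp_norm M p u + \<eta>/2) powr p)"
        using Lp_norm_le_iff[OF p uv(1) nn(1)] that by simp
      show "(\<integral>\<^sup>+x. ennreal (norm (v x) powr p) \<partial>M) \<le> ennreal ((Lp_norm M p v + \<eta>/2) powr p)"
        using Lp_norm_le_iff[OF p uv(2) nn(2)] that by simp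
    qed
    then show ?thesis unfolding * .
  qed
  have "(\<integral>\<^sup>+x. ennreal (norm (u x + v x) powr p) \<partial>M) < \<infinity>"
    using key[of 1] by (simp add: order_le_less_trans)
  then show mem: "(\<lambda>x. u x + v x) \<in> Lp M p"
    using strongly_measurable_add[OF m] unfolding Lp_def by simp
  show "Lp_norm M p (\<lambda>x. u x + v x) \<le> Lp_norm M p u + Lp_norm M p v"
  proof (rule field_le_epsilon)
    fix \<eta> :: real assume \<eta>: "0 < \<eta>"
    show "Lp_norm M p (\<lambda>x. u x + v x) \<le> Lp_norm M p u + Lp_norm M p v + \<eta>"
      using key[OF \<eta>] Lp_norm_le_iff[OF p mem, of "Lp_norm M p u + Lp_norm M p v + \<eta>"] \<eta>
        Lp_norm_nonneg[of M p u] Lp_norm_nonneg[of M p v] by simp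
  qed
qed

lemma Lp_scaleR:
  assumes p: "1 \<le> p" and u: "u \<in> Lp M p"
  shows "(\<lambda>x. c *\<^sub>R u x) \<in> Lp M p" "Lp_norm M p (\<lambda>x. c *\<^sub>R u x) = \<bar>c\<bar> * Lp_norm M p u"
proof -
  have m: "strongly_measurable M u" using u unfolding Lp_def by auto
  obtain u' where u': "simple_limit M u'" "AE x in M. u x = u' x"
    using strongly_measurable_obtain_simple_limit[OF m] by blast
  have [measurable]: "u' \<in> borel_measurable M"
    using u' simple_limit_borel_measurable by auto
  have "(\<integral>\<^sup>+x. ennreal (norm (c *\<^sub>R u x) powr p) \<partial>M) = (\<integral>\<^sup>+x. ennreal (\<bar>c\<bar> powr p) * ennreal (norm (u' x) powr p) \<partial>M)"
    by (rule nn_integral_cong_AE) (use u'(2) in eventually_elim, simp add: powr_mult flip: ennreal_mult)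
  also have "\<dots> = ennreal (\<bar>c\<bar> powr p) * (\<integral>\<^sup>+x. ennreal (norm (u' x) powr p) \<partial>M)"
    by (simp add: nn_integral_cmult)
  also have "(\<integral>\<^sup>+x. ennreal (norm (u' x) powr p) \<partial>M) = (\<integral>\<^sup>+x. ennreal (norm (u x) powr p) \<partial>M)"
    by (rule nn_integral_cong_AE) (use u'(2) in eventually_elim, simp)
  finally have eq: "(\<integral>\<^sup>+x. ennreal (norm (c *\<^sub>R u x) powr p) \<partial>M) = ennreal (\<bar>c\<bar> powr p) * (\<integral>\<^sup>+x. ennreal (norm (u x) powr p) \<partial>M)" .
  then show "(\<lambda>x. c *\<^sub>R u x) \<in> Lp M p"
    using u strongly_measurable_scaleR[OF m, of c] unfolding Lp_def
    by (auto simp: ennreal_mult_less_top)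
  show "Lp_norm M p (\<lambda>x. c *\<^sub>R u x) = \<bar>c\<bar> * Lp_norm M p u"
    unfolding Lp_norm_def eq using p by (simp add: enn2real_mult powr_mult powr_powr)
qed

lemma Lp_zero: "(\<lambda>x. 0) \<in> Lp M p"
  unfolding Lp_def using simple_limit_imp_strongly_measurable[OF simple_limit_const, of M 0] by simp

lemma subspace_Lp: "1 \<le> p \<Longrightarrow> fun_space.subspace (Lp M p)"
  unfolding fun_space.subspace_def
  using Lp_add_norm_le(1)[of p] Lp_scaleR(1)[of p] Lp_zero[of M p]
  by (auto simp: plus_fun_def zero_fun_def)

lemma seminorm_on_Lp: "1 \<le> p \<Longrightarrow> fun_space.seminorm_on (Lp M p) (Lp_norm M p)"
  unfolding fun_space.seminorm_on_def using Lp_add_norm_le(2)[of p] Lp_scaleR(2)[of p]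
  by (auto simp: plus_fun_def)

lemma Lp_diff: "1 \<le> p \<Longrightarrow> u \<in> Lp M p \<Longrightarrow> v \<in> Lp M p \<Longrightarrow> (\<lambda>x. u x - v x) \<in> Lp M p"
  using Lp_add_norm_le(1)[of p u M "\<lambda>x. (-1) *\<^sub>R v x"] Lp_scaleR(1)[of p v M "-1"] by simp

section \<open>Continuous functionals and convergence in the seminorm\<close>

lemma linear_form_on_Lp_dual: "\<phi> \<in> Lp_dual M p \<Longrightarrow> fun_space.linear_form_on (Lp M p) \<phi>"
  unfolding Lp_dual_def fun_space.linear_form_on_def by (auto simp: plus_fun_def)

lemma Lp_dual_diff:
  assumes "1 \<le> p" "fun_space.linear_form_on (Lp M p) \<phi>" "u \<in> Lp M p" "v \<in> Lp M p"
  shows "\<phi> (\<lambda>x. u x - v x) = \<phi> u - \<phi> v"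
proof -
  have "\<phi> (u + (\<lambda>x. (-1) *\<^sub>R v x)) = \<phi> u + \<phi> (\<lambda>x. (-1) *\<^sub>R v x)"
    using assms Lp_scaleR(1)[OF assms(1,4)] unfolding fun_space.linear_form_on_def by blast
  moreover have "\<phi> (\<lambda>x. (-1) *\<^sub>R v x) = (-1) * \<phi> v"
    using assms unfolding fun_space.linear_form_on_def by blast
  ultimately show ?thesis by (simp add: plus_fun_def)
qed

lemma Lp_dualI:
  assumes p: "1 \<le> p" and \<phi>: "fun_space.linear_form_on (Lp M p) \<phi>" "\<And>u. u \<in> Lp M p \<Longrightarrow> \<bar>\<phi> u\<bar> \<le> Lp_norm M p u"
  shows "\<phi> \<in> Lp_dual M p"
proof -
  have "\<exists>\<delta>>0. \<forall>v\<in>Lp M p. Lp_norm M p (\<lambda>x. v x - u x) < \<delta> \<longrightarrow> \<bar>\<phi> v - \<phi> u\<bar> < \<epsilon>"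
    if "u \<in> Lp M p" "0 < \<epsilon>" for u \<epsilon>
  proof (intro exI[of _ \<epsilon>] conjI ballI impI that(2))
    fix v assume v: "v \<in> Lp M p" "Lp_norm M p (\<lambda>x. v x - u x) < \<epsilon>"
    have "\<bar>\<phi> v - \<phi> u\<bar> = \<bar>\<phi> (\<lambda>x. v x - u x)\<bar>"
      using Lp_dual_diff[OF p \<phi>(1) v(1) that(1)] by simp
    also have "\<dots> \<le> Lp_norm M p (\<lambda>x. v x - u x)" by (intro \<phi>(2) Lp_diff p v that)
    finally show "\<bar>\<phi> v - \<phi> u\<bar> < \<epsilon>" using v(2) by simp
  qed
  then show ?thesis
    using \<phi>(1) unfolding Lp_dual_def fun_space.linear_form_on_def by (auto simp: plus_fun_def)
qed

lemma Lp_dual_tendsto: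
  assumes \<phi>: "\<phi> \<in> Lp_dual M p" and v: "v \<in> Lp M p" "\<And>n. w n \<in> Lp M p"
    and lim: "(\<lambda>n. Lp_norm M p (\<lambda>x. w n x - v x)) \<longlonglongrightarrow> 0"
  shows "(\<lambda>n. \<phi> (w n)) \<longlonglongrightarrow> \<phi> v"
proof (rule LIMSEQ_I)
  fix \<epsilon> :: real assume "0 < \<epsilon>"
  then obtain \<delta> where \<delta>: "0 < \<delta>" "\<And>u. u \<in> Lp M p \<Longrightarrow> Lp_norm M p (\<lambda>x. u x - v x) < \<delta> \<Longrightarrow> \<bar>\<phi> u - \<phi> v\<bar> < \<epsilon>"
    using \<phi> v(1) unfolding Lp_dual_def by blast
  have "\<forall>\<^sub>F n in sequentially. Lp_norm M p (\<lambda>x. w n x - v x) < \<delta>"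
    using lim \<delta>(1) by (rule order_tendstoD(2))
  then show "\<exists>N. \<forall>n\<ge>N. norm (\<phi> (w n) - \<phi> v) < \<epsilon>"
    using \<delta>(2) v(2) by (auto simp: eventually_sequentially)
qed

text \<open>The constant sequence \<open>u\<close> converges to \<open>v\<close> in the seminorm, so
  continuity at \<open>v\<close> forces equal values.\<close>

lemma Lp_dual_cong_AE:
  assumes p: "1 \<le> p" and \<phi>: "\<phi> \<in> Lp_dual M p" and u: "u \<in> Lp M p" and eq: "AE x in M. u x = v x"
  shows "\<phi> u = \<phi> v"
proof -
  have v: "v \<in> Lp M p" using Lp_cong_AE[OF u eq] .
  have "Lp_norm M p (\<lambda>x. u x - v x) = Lp_norm M p (\<lambda>x. 0 *\<^sub>R u x)"
    by (rule Lp_norm_cong_AE) (use eq in eventually_elim, simp)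
  also have "\<dots> = 0" using Lp_scaleR(2)[OF p u, of 0] by simp
  finally have "(\<lambda>n. \<phi> u) \<longlonglongrightarrow> \<phi> v"
    using u by (intro Lp_dual_tendsto[OF \<phi> v, of "\<lambda>_. u"]) simp_all
  then show ?thesis by (simp add: LIMSEQ_const_iff)
qed

lemma Lp_dominated:
  assumes "1 \<le> q" "strongly_measurable M u" "AE x in M. norm (u x) \<le> a x"
    "(\<integral>\<^sup>+x. ennreal (a x powr q) \<partial>M) < \<infinity>"
  shows "u \<in> Lp M q"
proof -
  have "(\<integral>\<^sup>+x. ennreal (norm (u x) powr q) \<partial>M) \<le> (\<integral>\<^sup>+x. ennreal (a x powr q) \<partial>M)"
  proof (rule nn_integral_mono_AE)
    show "AE x in M. ennreal (norm (u x) powr q) \<le> ennreal (a x powr q)"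
      using assms(3) by eventually_elim (use assms(1) in \<open>auto intro!: ennreal_leI powr_mono2\<close>)
  qed
  then show ?thesis using assms(2,4) unfolding Lp_def by simp
qed

lemma Lp_norm_dominated_convergence:
  assumes q: "1 \<le> q" and a: "a \<in> borel_measurable M" "\<And>x. 0 \<le> a x" "(\<integral>\<^sup>+x. ennreal (a x powr q) \<partial>M) < \<infinity>"
    and w: "\<And>n. simple_limit M (w n)" "\<And>n x. norm (w n x) \<le> a x"
    and v: "strongly_measurable M v" and lim: "AE x in M. (\<lambda>n. w n x) \<longlonglongrightarrow> v x"
  shows "(\<lambda>n. Lp_norm M q (\<lambda>x. w n x - v x)) \<longlonglongrightarrow> 0"
proof -
  obtain v' where v': "simple_limit M v'" "AE x in M. v x = v' x"
    using strongly_measurable_obtain_simple_limit[OF v] by blast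
  have [measurable]: "(\<lambda>x. w n x - v' x) \<in> borel_measurable M" for n
    using simple_limit_borel_measurable[OF simple_limit_diff[OF w(1) v'(1)]] .
  have "(\<lambda>n. \<integral>\<^sup>+x. ennreal (norm (w n x - v' x) powr q) \<partial>M) \<longlonglongrightarrow> (\<integral>\<^sup>+x. 0 \<partial>M)"
  proof (rule nn_integral_dominated_convergence[where w="\<lambda>x. ennreal (2 powr q) * ennreal (a x powr q)"])
    have [measurable]: "a \<in> borel_measurable M" by (rule a(1))
    show "(\<lambda>x. ennreal (2 powr q) * ennreal (a x powr q)) \<in> borel_measurable M" by measurable
    have "(\<integral>\<^sup>+x. ennreal (2 powr q) * ennreal (a x powr q) \<partial>M) = ennreal (2 powr q) * (\<integral>\<^sup>+x. ennreal (a x powr q) \<partial>M)"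
      by (intro nn_integral_cmult) measurable
    also have "\<dots> < \<infinity>" using a(3) by (simp add: ennreal_mult_less_top)
    finally show "(\<integral>\<^sup>+x. ennreal (2 powr q) * ennreal (a x powr q) \<partial>M) < \<infinity>" .
    show "AE x in M. ennreal (norm (w n x - v' x) powr q) \<le> ennreal (2 powr q) * ennreal (a x powr q)" for n
      using lim v'(2)
    proof eventually_elim
      case (elim x)
      have "norm (v' x) \<le> a x"
        using elim w(2) by (intro LIMSEQ_le_const2[OF tendsto_norm]) auto
      then have "norm (w n x - v' x) \<le> 2 * a x"
        using norm_triangle_ineq4[of "w n x" "v' x"] w(2)[of n x] by simp
      then have "norm (w n x - v' x) powr q \<le> (2 * a x) powr q"
        using q by (intro powr_mono2) auto
      then show ?case using a(2)[of x] by (simp add: powr_mult flip: ennreal_mult)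
    qed
    show "AE x in M. (\<lambda>n. ennreal (norm (w n x - v' x) powr q)) \<longlonglongrightarrow> 0"
      using lim v'(2)
    proof eventually_elim
      case (elim x)
      have "(\<lambda>n. w n x - v' x) \<longlonglongrightarrow> 0" using elim by (simp add: LIM_zero_iff)
      then have "(\<lambda>n. norm (w n x - v' x) powr q) \<longlonglongrightarrow> 0"
        using q by (intro tendsto_zero_powrI[where b=q]) (auto intro: tendsto_norm_zero)
      then have "(\<lambda>n. ennreal (norm (w n x - v' x) powr q)) \<longlonglongrightarrow> ennreal 0" by (intro tendsto_intros)
      then show ?case by simp
    qed
  qed measurable
  then have "(\<lambda>n. enn2real (\<integral>\<^sup>+x. ennreal (norm (w n x - v' x) powr q) \<partial>M)) \<longlonglongrightarrow> enn2real 0"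
    by (intro tendsto_enn2real) auto
  then have "(\<lambda>n. Lp_norm M q (\<lambda>x. w n x - v' x)) \<longlonglongrightarrow> 0"
    unfolding Lp_norm_def using q by (intro tendsto_zero_powrI[where b="1/q"]) auto
  moreover have "Lp_norm M q (\<lambda>x. w n x - v' x) = Lp_norm M q (\<lambda>x. w n x - v x)" for n
    by (rule Lp_norm_cong_AE) (use v'(2) in eventually_elim, simp)
  ultimately show ?thesis by simp
qed

subsection \<open>Dominated weak convergence\<close>

lemma simple_limit_cong_sets:
  assumes "sets N = sets M"
  shows "simple_limit N w \<longleftrightarrow> simple_limit M w"
  unfolding simple_limit_def simple_function_def assms sets_eq_imp_space_eq[OF assms] ..

text \<open>After division by \<open>a\<close> the functions take values in the unit ball, and
  \<open>a\<^sup>q \<mu>\<close> is a finite measure.\<close>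

lemma dominated_weak_limit:
  fixes V :: "nat \<Rightarrow> 'a \<Rightarrow> 'e::banach"
  assumes uc: "uniformly_convex TYPE('e)"
    and a: "a \<in> borel_measurable M" "\<And>x. 0 \<le> a x" "(\<integral>\<^sup>+x. ennreal (a x powr q) \<partial>M) < \<infinity>"
    and V: "\<And>n. strongly_measurable M (V n)" "\<And>n. AE x in M. norm (V n x) \<le> a x"
    and lim: "AE x in M. weak_conv (\<lambda>n. V n x) (v x)"
    and Q: "\<And>n. Q (V n)" "\<And>u w. Q u \<Longrightarrow> Q w \<Longrightarrow> Q (\<lambda>x. (1/2) *\<^sub>R (u x + w x))"
      "\<And>u w. Q u \<Longrightarrow> AE x in M. u x = w x \<Longrightarrow> Q w"
  obtains w where "\<And>n. Q (w n)" "\<And>n. simple_limit M (w n)" "\<And>n x. norm (w n x) \<le> a x"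
    "AE x in M. (\<lambda>n. w n x) \<longlonglongrightarrow> v x" "strongly_measurable M v"
proof -
  note [measurable] = a(1)
  define N where "N = density M (\<lambda>x. ennreal (a x powr q))"
  have setsN: "sets N = sets M" by (simp add: N_def)
  note slN = simple_limit_cong_sets[OF setsN]
  have AEN: "(AE x in N. P x) \<longleftrightarrow> (AE x in M. 0 < a x \<longrightarrow> P x)" for P
    unfolding N_def using a(2) by (subst AE_density) (auto simp: less_le)
  interpret N: finite_measure N
  proof
    show "emeasure N (space N) \<noteq> \<infinity>"
      using a(3) by (simp add: N_def emeasure_density cong: nn_integral_cong)
  qed
  have "\<exists>V'. simple_limit M V' \<and> (AE x in M. V n x = V' x)" for n
    using strongly_measurable_obtain_simple_limit[OF V(1)] by metis
  then obtain V' where V': "\<And>n. simple_limit M (V' n)" "\<And>n. AE x in M. V n x = V' n x" by metis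
  \<comment> \<open>The cutoff replaces the values by \<open>0\<close> where the majorant fails, and
    division by zero does the same where \<open>a\<close> vanishes. Thus \<open>y n\<close> is in
    the unit ball everywhere, not only almost everywhere.\<close>
  define c where "c n x = (if norm (V' n x) \<le> a x then 1 / a x else 0)" for n x
  define y where "y n x = c n x *\<^sub>R V' n x" for n x
  have cm: "c n \<in> borel_measurable M" for n
  proof -
    have [measurable]: "V' n \<in> borel_measurable M" using simple_limit_borel_measurable[OF V'(1)] .
    show ?thesis unfolding c_def by measurable
  qed
  have y_sl: "simple_limit N (y n)" for n
    unfolding slN y_def by (intro simple_limit_scaleR simple_limit_real cm V')
  have y_le: "norm (y n x) \<le> 1" for n x
    using a(2)[of x] by (auto simp: y_def c_def divide_le_eq_1 not_le)
  have ay: "AE x in M. \<forall>n. V n x = a x *\<^sub>R y n x"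
    unfolding AE_all_countable
  proof
    fix n
    show "AE x in M. V n x = a x *\<^sub>R y n x"
      using V(2)[of n] V'(2)[of n] by eventually_elim (auto simp: y_def c_def)
  qed
  define P where "P w \<longleftrightarrow> Q (\<lambda>x. a x *\<^sub>R w x)" for w
  have P1: "P (y n)" for n
    unfolding P_def by (rule Q(3)[OF Q(1)[of n]]) (use ay in eventually_elim, auto)
  have P2: "P (\<lambda>x. (1/2) *\<^sub>R (u x + w x))" if "P u" "P w" for u w
  proof -
    have "(\<lambda>x. a x *\<^sub>R (1/2) *\<^sub>R (u x + w x)) = (\<lambda>x. (1/2) *\<^sub>R (a x *\<^sub>R u x + a x *\<^sub>R w x))"
      by (simp add: scaleR_right_distrib)
    then show ?thesis using Q(2) that unfolding P_def by simp
  qed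
  obtain w l where w: "\<And>n. P (w n)" "\<And>n. simple_limit N (w n)" "\<And>n x. norm (w n x) \<le> 1"
    "AE x in N. (\<lambda>n. w n x) \<longlonglongrightarrow> l x"
    "\<And>x \<phi> c. (\<lambda>n. w n x) \<longlonglongrightarrow> l x \<Longrightarrow> bounded_linear \<phi> \<Longrightarrow> (\<lambda>n. \<phi> (y n x)) \<longlonglongrightarrow> c \<Longrightarrow> \<phi> (l x) = (c::real)"
    by (rule N.uniformly_convex_weak_limit[where P=P and v=y, OF uc zero_less_one y_sl y_le P1 P2]) blast+
  have l: "AE x in M. v x = a x *\<^sub>R l x \<and> (\<lambda>n. a x *\<^sub>R w n x) \<longlonglongrightarrow> v x"
    using lim ay w(4)[unfolded AEN]
  proof eventually_elim
    case (elim x)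
    have le: "norm (V n x) \<le> a x" for n
      using elim(2) mult_left_mono[OF y_le a(2)] a(2)[of x] by simp
    show ?case
    \<comment> \<open>Almost everywhere for \<open>N\<close> says nothing on the zero set of
      \<open>a\<close>. There all \<open>V n x\<close> vanish, and so does their weak limit.\<close>
    proof (cases "a x = 0")
      case True
      then have "norm (v x) \<le> 0" using weak_conv_norm_le[OF elim(1) le] by simp
      then show ?thesis using True by simp
    next
      case False
      then have pos: "0 < a x" using a(2)[of x] by (simp add: less_le)
      then have wl: "(\<lambda>n. w n x) \<longlonglongrightarrow> l x" using elim by blast
      have "a x *\<^sub>R l x = v x"
      proof (rule eq_if_bounded_linear_eq)
        fix \<phi> :: "'e \<Rightarrow> real" assume \<phi>: "bounded_linear \<phi>"
        note lin = bounded_linear.linear[OF \<phi>]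
        have "(\<lambda>n. \<phi> (V n x) / a x) \<longlonglongrightarrow> \<phi> (v x) / a x"
          using elim(1) \<phi> pos unfolding weak_conv_def by (intro tendsto_intros) auto
        moreover have "\<phi> (V n x) / a x = \<phi> (y n x)" for n
          using elim(2) pos linear_scale[OF lin] by simp
        ultimately have "\<phi> (l x) = \<phi> (v x) / a x" using w(5)[OF wl \<phi>] by simp
        then show "\<phi> (a x *\<^sub>R l x) = \<phi> (v x)" using pos linear_scale[OF lin] by simp
      qed
      then show ?thesis using tendsto_scaleR[OF tendsto_const wl, of "a x"] by simp
    qed
  qed
  have "strongly_measurable N l"
    using N.strongly_measurable_AE_limit[OF w(2,4)] .
  then obtain l' where l': "simple_limit N l'" "AE x in N. l x = l' x"
    using strongly_measurable_obtain_simple_limit by blast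
  \<comment> \<open>Measurability of \<open>l\<close> is known for \<open>N\<close> only. Its
    representative \<open>l'\<close> is a limit of simple functions everywhere, a property of the
    common sigma-algebra, and multiplication by \<open>a\<close> hides the set that \<open>N\<close>
    does not see.\<close>
  have "strongly_measurable M (\<lambda>x. a x *\<^sub>R l' x)"
    using l'(1) unfolding slN
    by (intro simple_limit_imp_strongly_measurable simple_limit_scaleR simple_limit_real a)
  moreover have "AE x in M. a x *\<^sub>R l' x = v x"
    using l l'(2)[unfolded AEN] by eventually_elim (use a(2) in \<open>auto simp: less_le\<close>)
  ultimately have "strongly_measurable M v" by (rule strongly_measurable_cong_AE)
  moreover have "simple_limit M (\<lambda>x. a x *\<^sub>R w n x)" for n
    using w(2) unfolding slN by (intro simple_limit_scaleR simple_limit_real a)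
  moreover have "norm (a x *\<^sub>R w n x) \<le> a x" for n x
    using mult_left_mono[OF w(3) a(2)] a(2)[of x] by simp
  moreover have "AE x in M. (\<lambda>n. a x *\<^sub>R w n x) \<longlonglongrightarrow> v x" using l by eventually_elim (erule conjunct2)
  ultimately show thesis using that[of "\<lambda>n x. a x *\<^sub>R w n x"] w(1) unfolding P_def by blast
qed

lemma weak_conv_subseq: "weak_conv u l \<Longrightarrow> strict_mono r \<Longrightarrow> weak_conv (\<lambda>n. u (r n)) l"
  unfolding weak_conv_def using LIMSEQ_subseq_LIMSEQ[unfolded o_def] by blast

text \<open>A functional that stays on one side of \<open>\<phi> v\<close> along a subsequence does
  so on averages as well. But suitable averages converge to \<open>v\<close> pointwise in norm below
  the majorant \<open>a\<close>, hence in the seminorm.\<close>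

lemma dominated_weak_conv_Lp:
  fixes V :: "nat \<Rightarrow> 'a \<Rightarrow> 'e::banach"
  assumes uc: "uniformly_convex TYPE('e)" and q: "1 \<le> q"
    and a: "a \<in> borel_measurable M" "\<And>x. 0 \<le> a x" "(\<integral>\<^sup>+x. ennreal (a x powr q) \<partial>M) < \<infinity>"
    and V: "\<And>n. strongly_measurable M (V n)" "\<And>n. AE x in M. norm (V n x) \<le> a x"
    and lim: "AE x in M. weak_conv (\<lambda>n. V n x) (v x)"
  shows "Lp_weak_conv M q V v"
proof -
  have VL: "V n \<in> Lp M q" for n using Lp_dominated[OF q V(1) V(2) a(3)] .
  \<comment> \<open>With the trivial property the averages serve only to exhibit \<open>v\<close> as
    a norm limit, which gives its measurability.\<close>
  have vm: "strongly_measurable M v"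
    by (rule dominated_weak_limit[OF uc a V lim, of "\<lambda>_. True"]) auto
  have "AE x in M. \<forall>n. norm (V n x) \<le> a x" unfolding AE_all_countable using V(2) by blast
  with lim have "AE x in M. norm (v x) \<le> a x"
    by eventually_elim (metis weak_conv_norm_le)
  then have vL: "v \<in> Lp M q" using Lp_dominated[OF q vm _ a(3)] by blast
  have "(\<lambda>n. \<phi> (V n)) \<longlonglongrightarrow> \<phi> v" if \<phi>: "\<phi> \<in> Lp_dual M q" for \<phi>
  proof (rule ccontr)
    assume "\<not> ?thesis"
    then obtain \<epsilon> \<sigma> r where \<epsilon>: "0 < \<epsilon>" and r: "strict_mono (r :: nat \<Rightarrow> nat)"
      and ge: "\<And>n. \<epsilon> \<le> \<sigma> * (\<phi> (V (r n)) - \<phi> v)"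
      by (rule not_tendsto_imp_subseq) blast
    define Q where "Q u \<longleftrightarrow> u \<in> Lp M q \<and> \<epsilon> \<le> \<sigma> * (\<phi> u - \<phi> v)" for u
    have lin: "\<phi> (\<lambda>x. u x + w x) = \<phi> u + \<phi> w" "\<phi> (\<lambda>x. c *\<^sub>R u x) = c * \<phi> u"
      if "u \<in> Lp M q" "w \<in> Lp M q" for u w c
      using \<phi> that unfolding Lp_dual_def by blast+
    have limr: "AE x in M. weak_conv (\<lambda>n. V (r n) x) (v x)"
      using lim by eventually_elim (rule weak_conv_subseq[OF _ r])
    have Q1: "Q (V (r n))" for n using VL ge unfolding Q_def by blast
    have Q2: "Q (\<lambda>x. (1/2) *\<^sub>R (u x + w x))" if "Q u" "Q w" for u w
    proof -
      have uw: "u \<in> Lp M q" "w \<in> Lp M q" using that unfolding Q_def by auto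
      note add = Lp_add_norm_le(1)[OF q uw]
      have "\<phi> (\<lambda>x. (1/2) *\<^sub>R (u x + w x)) = (1/2) * (\<phi> u + \<phi> w)"
        using lin(1)[OF uw] lin(2)[OF add add, of "1/2"] by simp
      then have "\<sigma> * (\<phi> (\<lambda>x. (1/2) *\<^sub>R (u x + w x)) - \<phi> v) = (\<sigma> * (\<phi> u - \<phi> v) + \<sigma> * (\<phi> w - \<phi> v)) / 2"
        by (simp only:) (simp add: field_simps)
      then show ?thesis
        using that Lp_scaleR(1)[OF q add, of "1/2"] unfolding Q_def by argo
    qed
    have Q3: "Q w" if "Q u" "AE x in M. u x = w x" for u w
      using that Lp_cong_AE[of u M q w] Lp_dual_cong_AE[OF q \<phi>, of u w] unfolding Q_def by auto
    obtain w where w: "\<And>n. Q (w n)" "\<And>n. simple_limit M (w n)" "\<And>n x. norm (w n x) \<le> a x"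
      "AE x in M. (\<lambda>n. w n x) \<longlonglongrightarrow> v x" "strongly_measurable M v"
      by (rule dominated_weak_limit[where V="\<lambda>n. V (r n)" and Q=Q, OF uc a V(1,2) limr Q1 Q2 Q3]) blast+
    have "(\<lambda>n. \<phi> (w n)) \<longlonglongrightarrow> \<phi> v"
      using Lp_norm_dominated_convergence[OF q a w(2,3) vm w(4)] w(1)
      by (intro Lp_dual_tendsto[OF \<phi> vL]) (auto simp: Q_def)
    then have "(\<lambda>n. \<sigma> * (\<phi> (w n) - \<phi> v)) \<longlonglongrightarrow> \<sigma> * (\<phi> v - \<phi> v)" by (intro tendsto_intros)
    then have "\<epsilon> \<le> \<sigma> * (\<phi> v - \<phi> v)"
      using w(1) by (intro LIMSEQ_le_const) (auto simp: Q_def)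
    then show False using \<epsilon> by simp
  qed
  then show ?thesis using VL vL unfolding Lp_weak_conv_def by blast
qed

subsection \<open>Weak convergence in \<open>L\<^sup>p\<close> and operators into \<open>L\<^sup>\<infinity>\<close>\<close>

lemma strongly_measurable_AE_closure_countable:
  assumes "strongly_measurable M w"
  obtains S where "countable S" "AE x in M. w x \<in> closure S"
proof -
  obtain s where s: "\<And>n::nat. simple_function M (s n)" "AE x in M. (\<lambda>n. s n x) \<longlonglongrightarrow> w x"
    using assms unfolding strongly_measurable_def by blast
  define S where "S = (\<Union>n. s n ` space M)"
  have "countable S"
    unfolding S_def using simple_functionD(1)[OF s(1)] by (simp add: countable_finite)
  moreover have "AE x in M. w x \<in> closure S"
    using s(2) AE_space
  proof eventually_elim
    case (elim x)
    then show ?case unfolding closure_sequential by (intro exI[of _ "\<lambda>n. s n x"]) (auto simp: S_def)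
  qed
  ultimately show thesis by (rule that)
qed

text \<open>Iterated midpoints, unlike the convex hull, keep the set countable, and the minimisation
  asks only for midpoints. Closedness under midpoints passes to the closure by sequences.\<close>

lemma countable_midpoint_closed_superset:
  fixes T :: "'e::real_normed_vector set"
  assumes "countable T"
  obtains S where "countable S" "T \<subseteq> S"
    "\<And>x y. x \<in> closure S \<Longrightarrow> y \<in> closure S \<Longrightarrow> (1/2) *\<^sub>R (x + y) \<in> closure S"
proof -
  define F where "F = rec_nat T (\<lambda>_ X. X \<union> (\<lambda>(x, y). (1/2) *\<^sub>R (x + y)) ` (X \<times> X))"
  have F: "F 0 = T" "F (Suc n) = F n \<union> (\<lambda>(x, y). (1/2) *\<^sub>R (x + y)) ` (F n \<times> F n)" for n
    by (simp_all add: F_def)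
  have "countable (F n)" for n by (induction n) (use assms in \<open>auto simp: F\<close>)
  then have cS: "countable (\<Union>n. F n)" by auto
  have mono: "F m \<subseteq> F n" if "m \<le> n" for m n
    using that by (rule lift_Suc_mono_le[rotated]) (auto simp: F)
  have mid: "(1/2) *\<^sub>R (x + y) \<in> (\<Union>n. F n)" if xy: "x \<in> (\<Union>n. F n)" "y \<in> (\<Union>n. F n)" for x y
  proof -
    obtain m n where "x \<in> F m" "y \<in> F n" using xy by blast
    then have "x \<in> F (max m n)" "y \<in> F (max m n)"
      using mono[of m "max m n"] mono[of n "max m n"] by auto
    then have "(1/2) *\<^sub>R (x + y) \<in> F (Suc (max m n))" unfolding F(2) by force
    then show ?thesis by blast
  qed
  have "(1/2) *\<^sub>R (x + y) \<in> closure (\<Union>n. F n)"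
    if xy: "x \<in> closure (\<Union>n. F n)" "y \<in> closure (\<Union>n. F n)" for x y
  proof -
    obtain X Y where "\<And>n. X n \<in> (\<Union>n. F n)" "X \<longlonglongrightarrow> x" "\<And>n. Y n \<in> (\<Union>n. F n)" "Y \<longlonglongrightarrow> y"
      using xy unfolding closure_sequential by metis
    then show ?thesis
      unfolding closure_sequential
      by (intro exI[of _ "\<lambda>n. (1/2) *\<^sub>R (X n + Y n)"] conjI allI mid tendsto_intros)
  qed
  then show thesis using that[OF cS] F(1) by blast
qed

section \<open>Bounds for operators into the essentially bounded functions\<close>

lemma continuous_linear_Lp_LinfD:
  assumes "continuous_linear_Lp_Linf M p I"
  shows "u \<in> Lp M p \<Longrightarrow> I u \<in> Linf M"
    and "u \<in> Lp M p \<Longrightarrow> v \<in> Lp M p \<Longrightarrow> AE x in M. I (\<lambda>y. u y + v y) x = I u x + I v x"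
    and "u \<in> Lp M p \<Longrightarrow> AE x in M. I (\<lambda>y. c *\<^sub>R u y) x = c *\<^sub>R I u x"
    and "u \<in> Lp M p \<Longrightarrow> v \<in> Lp M p \<Longrightarrow> AE x in M. u x = v x \<Longrightarrow> AE x in M. I u x = I v x"
    and "u \<in> Lp M p \<Longrightarrow> 0 < \<epsilon> \<Longrightarrow> \<exists>\<delta>>0. \<forall>v\<in>Lp M p. Lp_norm M p (\<lambda>x. v x - u x) < \<delta> \<longrightarrow>
      Linf_norm M (\<lambda>x. I v x - I u x) < \<epsilon>"
  using assms unfolding continuous_linear_Lp_Linf_def class_map_def by blast+

text \<open>Continuity at the zero function, with the infimum in \<open>Linf_norm\<close> unfolded
  into an actual bound. The image of the zero function vanishes only almost everywhere and has to be
  carried along.\<close>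

lemma continuous_linear_Lp_Linf_AE_le:
  assumes I: "continuous_linear_Lp_Linf M p I" and \<eta>: "0 < \<eta>"
  obtains \<delta> where "0 < \<delta>" "\<And>v. v \<in> Lp M p \<Longrightarrow> Lp_norm M p v < \<delta> \<Longrightarrow> AE x in M. norm (I v x) \<le> \<eta>"
proof -
  have Z: "(\<lambda>x. 0) \<in> Lp M p" by (rule Lp_zero)
  have I0: "AE x in M. I (\<lambda>y. 0) x = 0" using continuous_linear_Lp_LinfD(3)[OF I Z, of 0] by simp
  obtain \<delta> where \<delta>: "0 < \<delta>" "\<And>v. v \<in> Lp M p \<Longrightarrow> Lp_norm M p (\<lambda>x. v x - 0) < \<delta> \<Longrightarrow>
      Linf_norm M (\<lambda>x. I v x - I (\<lambda>y. 0) x) < \<eta>"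
    using continuous_linear_Lp_LinfD(5)[OF I Z \<eta>] by blast
  have "AE x in M. norm (I v x) \<le> \<eta>" if v: "v \<in> Lp M p" "Lp_norm M p v < \<delta>" for v
  proof -
    have less: "Inf {C. 0 \<le> C \<and> (AE x in M. norm (I v x - I (\<lambda>y. 0) x) \<le> C)} < \<eta>"
      using \<delta>(2)[OF v(1)] v(2) unfolding Linf_norm_def by simp
    have "I v \<in> Linf M" using continuous_linear_Lp_LinfD(1)[OF I v(1)] .
    then obtain C where C: "AE x in M. norm (I v x) \<le> C" unfolding Linf_def by blast
    have "AE x in M. norm (I v x - I (\<lambda>y. 0) x) \<le> max C 0"
      using C I0 by eventually_elim simp
    then have "max C 0 \<in> {C. 0 \<le> C \<and> (AE x in M. norm (I v x - I (\<lambda>y. 0) x) \<le> C)}"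
      by simp
    \<comment> \<open>Essential boundedness of \<open>I v\<close> makes the set of bounds nonempty;
      the infimum of an empty set would carry no information.\<close>
    then have "{C. 0 \<le> C \<and> (AE x in M. norm (I v x - I (\<lambda>y. 0) x) \<le> C)} \<noteq> {}" by blast
    from cInf_lessD[OF this less] obtain C' where
      "AE x in M. norm (I v x - I (\<lambda>y. 0) x) \<le> C'" "C' < \<eta>" by blast
    then show ?thesis using I0 by (elim AE_mp) (auto intro!: AE_I2)
  qed
  then show thesis using that[OF \<delta>(1)] by blast
qed

text \<open>Uniform boundedness in the seminorm of \<open>Lp M p\<close>, transported by continuity
  of \<open>I\<close> at zero and homogeneity.\<close>

lemma Lp_weakly_null_imp_AE_bounded:
  fixes I :: "('a \<Rightarrow> 'e::real_normed_vector) \<Rightarrow> ('a \<Rightarrow> 'e)"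
  assumes p: "1 \<le> p" and I: "continuous_linear_Lp_Linf M p I" and z: "\<And>n. z n \<in> Lp M p"
    and lim: "\<And>\<phi>. \<phi> \<in> Lp_dual M p \<Longrightarrow> (\<lambda>n. \<phi> (z n)) \<longlonglongrightarrow> 0"
  obtains C where "\<And>n. AE x in M. norm (I (z n) x) \<le> C"
proof -
  obtain B where B: "\<And>n. Lp_norm M p (z n) \<le> B"
  proof (rule fun_space.weakly_bounded_imp_bounded[OF subspace_Lp[OF p] seminorm_on_Lp[OF p] z])
    fix \<phi> :: "('a \<Rightarrow> 'e) \<Rightarrow> real"
    assume "fun_space.linear_form_on (Lp M p) \<phi>" "\<And>v. v \<in> Lp M p \<Longrightarrow> \<bar>\<phi> v\<bar> \<le> Lp_norm M p v"
    then have "(\<lambda>n. \<phi> (z n)) \<longlonglongrightarrow> 0" by (intro lim Lp_dualI[OF p])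
    then have "Bseq (\<lambda>n. \<phi> (z n))" by (intro convergent_imp_Bseq) (auto simp: convergent_def)
    then show "\<exists>C. \<forall>n. \<bar>\<phi> (z n)\<bar> \<le> C" unfolding Bseq_def by auto
  qed blast
  have B0: "0 \<le> B" using B[of 0] Lp_norm_nonneg[of M p "z 0"] by linarith
  obtain \<delta> where \<delta>: "0 < \<delta>" "\<And>v. v \<in> Lp M p \<Longrightarrow> Lp_norm M p v < \<delta> \<Longrightarrow> AE x in M. norm (I v x) \<le> 1"
    using continuous_linear_Lp_Linf_AE_le[OF I, of 1] by auto
  \<comment> \<open>Scaling by \<open>c\<close> brings all \<open>z n\<close> strictly below
    \<open>\<delta>\<close>; the \<open>+ 1\<close> covers \<open>B = 0\<close>.\<close>
  define c where "c = \<delta> / (B + 1)"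
  have c: "0 < c" "c * B < \<delta>" using \<delta>(1) B0 by (auto simp: c_def field_simps)
  have "AE x in M. norm (I (z n) x) \<le> 1 / c" for n
  proof -
    have "Lp_norm M p (\<lambda>x. c *\<^sub>R z n x) < \<delta>"
    proof -
      have "c * Lp_norm M p (z n) \<le> c * B" using B c by (intro mult_left_mono) auto
      also have "\<dots> < \<delta>" by (rule c(2))
      finally show ?thesis using Lp_scaleR(2)[OF p z, of c n] c(1) by simp
    qed
    then have "AE x in M. norm (I (\<lambda>x. c *\<^sub>R z n x) x) \<le> 1"
      using \<delta>(2)[OF Lp_scaleR(1)[OF p z]] by blast
    moreover have "AE x in M. I (\<lambda>x. c *\<^sub>R z n x) x = c *\<^sub>R I (z n) x"
      using continuous_linear_Lp_LinfD(3)[OF I z] .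
    ultimately show ?thesis
      by eventually_elim (use c in \<open>simp add: field_simps\<close>)
  qed
  then show thesis by (rule that)
qed

text \<open>Otherwise a subsequence of \<open>\<sigma> \<psi>(I (z n))\<close> exceeds \<open>\<epsilon>\<close> on sets \<open>C 0 \<supseteq> C 1 \<supseteq> \<dots>\<close> of positive measure.
  Then so do all convex combinations of its members on some \<open>C j\<close>, so that these stay away from \<open>0\<close> in
  \<open>L\<^sup>p\<close>, and the subsequence is separated from \<open>0\<close> by a continuous functional.\<close>

lemma Lp_weakly_null_imp_AE_functional_null:
  fixes I :: "('a \<Rightarrow> 'e::banach) \<Rightarrow> ('a \<Rightarrow> 'e)"
  assumes p: "1 \<le> p" and I: "continuous_linear_Lp_Linf M p I" and z: "\<And>n. z n \<in> Lp M p"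
    and lim: "\<And>\<phi>. \<phi> \<in> Lp_dual M p \<Longrightarrow> (\<lambda>n. \<phi> (z n)) \<longlonglongrightarrow> 0" and \<psi>: "bounded_linear (\<psi> :: 'e \<Rightarrow> real)"
  shows "AE x in M. (\<lambda>n. \<psi> (I (z n) x)) \<longlonglongrightarrow> 0"
proof (rule ccontr)
  assume contr: "\<not> ?thesis"
  have "strongly_measurable M (I (z n))" for n
    using continuous_linear_Lp_LinfD(1)[OF I z] unfolding Linf_def by blast
  then have "\<exists>h. simple_limit M h \<and> (AE x in M. I (z n) x = h x)" for n
    using strongly_measurable_obtain_simple_limit by metis
  then obtain h where h: "\<And>n. simple_limit M (h n)" "\<And>n. AE x in M. I (z n) x = h n x" by metis
  define g where "g n x = \<psi> (h n x)" for n x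
  have [measurable]: "g n \<in> borel_measurable M" for n
    unfolding g_def using h(1)[of n] \<psi>
    by (intro simple_limit_borel_measurable simple_limit_compose2[where h="\<lambda>x _. \<psi> x" and v="h n"])
      (auto intro: bounded_linear.tendsto)
  have hAE: "AE x in M. \<forall>n. I (z n) x = h n x" unfolding AE_all_countable using h(2) by blast
  \<comment> \<open>Failure of convergence to \<open>0\<close> is split into countably many
    measurable cases, by the sign \<open>\<sigma>\<close> and the threshold exceeded infinitely
    often. If all of these sets were null, convergence would hold almost everywhere.\<close>
  define B where "B \<sigma> m = {x\<in>space M. \<forall>N. \<exists>n\<ge>N. 1 / real (Suc m) < \<sigma> * g n x}" for \<sigma> m
  have [measurable]: "B \<sigma> m \<in> sets M" for \<sigma> m unfolding B_def by measurable
  have "\<exists>\<sigma>\<in>{1, -1}. \<exists>m. B \<sigma> m \<notin> null_sets M"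
  proof (rule ccontr)
    assume "\<not> ?thesis"
    then have "AE x in M. \<forall>m. x \<notin> B 1 m" "AE x in M. \<forall>m. x \<notin> B (-1) m"
      unfolding AE_all_countable by (auto intro: AE_not_in)
    then have "AE x in M. (\<lambda>n. \<psi> (I (z n) x)) \<longlonglongrightarrow> 0"
      using hAE AE_space
    proof eventually_elim
      case (elim x)
      have "(\<lambda>n. g n x) \<longlonglongrightarrow> 0"
      proof (rule LIMSEQ_I)
        fix \<epsilon> :: real assume "0 < \<epsilon>"
        then obtain m where m: "1 / real (Suc m) < \<epsilon>" using nat_approx_posE by blast
        have bound: "\<exists>N. \<forall>n\<ge>N. \<sigma> * g n x \<le> 1 / real (Suc m)" if "\<sigma> = 1 \<or> \<sigma> = -1" for \<sigma>
          using elim that unfolding B_def by (auto simp: not_less)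
        obtain N where "\<And>n. N \<le> n \<Longrightarrow> 1 * g n x \<le> 1 / real (Suc m)"
          using bound[of 1] by blast
        moreover obtain N' where "\<And>n. N' \<le> n \<Longrightarrow> (-1) * g n x \<le> 1 / real (Suc m)"
          using bound[of "-1"] by blast
        ultimately have "norm (g n x - 0) < \<epsilon>" if "max N N' \<le> n" for n
          using that m by (force simp: abs_if)
        then show "\<exists>no. \<forall>n\<ge>no. norm (g n x - 0) < \<epsilon>" by blast
      qed
      then show ?case using elim by (simp add: g_def)
    qed
    then show False using contr by blast
  qed
  then obtain \<sigma> m where "\<sigma> \<in> {1, -1}" and nonnull: "B \<sigma> m \<notin> null_sets M" by blast
  then have \<sigma>: "\<bar>\<sigma>\<bar> = 1" by auto
  define \<epsilon> where "\<epsilon> = 1 / real (Suc m)"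
  have \<epsilon>: "0 < \<epsilon>" by (simp add: \<epsilon>_def)
  \<comment> \<open>Each point of \<open>C\<close> exceeds the threshold for arbitrarily large
    indices, so \<open>C\<close> is a countable union of the exceedance sets with index at least
    \<open>N\<close>; one of them is not null.\<close>
  have shrink: "\<exists>n\<ge>N. {x\<in>C. \<epsilon> < \<sigma> * g n x} \<in> sets M \<and> {x\<in>C. \<epsilon> < \<sigma> * g n x} \<notin> null_sets M"
    if C: "C \<in> sets M" "C \<notin> null_sets M" "C \<subseteq> B \<sigma> m" for C N
  proof -
    have CM: "C \<subseteq> space M" using C(1) by (rule sets.sets_into_space)
    have meas: "{x\<in>C. \<epsilon> < \<sigma> * g n x} \<in> sets M" for n
    proof -
      have "{x\<in>C. \<epsilon> < \<sigma> * g n x} = C \<inter> {x\<in>space M. \<epsilon> < \<sigma> * g n x}" using CM by blast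
      then show ?thesis using C(1) by simp
    qed
    have "C = (\<Union>n\<in>{N..}. {x\<in>C. \<epsilon> < \<sigma> * g n x})"
      using C(3) unfolding B_def \<epsilon>_def by auto
    then have "\<exists>n\<in>{N..}. {x\<in>C. \<epsilon> < \<sigma> * g n x} \<notin> null_sets M"
      using C(2) null_sets_UN'[of "{N..}" "\<lambda>n. {x\<in>C. \<epsilon> < \<sigma> * g n x}" M] by (metis countableI_type)
    then show ?thesis using meas by auto
  qed
  define P where "P rC \<longleftrightarrow> snd rC \<in> sets M \<and> snd rC \<notin> null_sets M \<and> snd rC \<subseteq> B \<sigma> m \<and>
    (\<forall>x\<in>snd rC. \<epsilon> < \<sigma> * g (fst rC) x)" for rC :: "nat \<times> 'a set"
  have next_set: "\<exists>rC. P rC \<and> N \<le> fst rC \<and> snd rC \<subseteq> C"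
    if C: "C \<in> sets M" "C \<notin> null_sets M" "C \<subseteq> B \<sigma> m" for C N
  proof -
    obtain n where n: "N \<le> n" "{x\<in>C. \<epsilon> < \<sigma> * g n x} \<in> sets M" "{x\<in>C. \<epsilon> < \<sigma> * g n x} \<notin> null_sets M"
      using shrink[OF C] by blast
    then show ?thesis
      unfolding P_def using C(3) by (intro exI[of _ "(n, {x\<in>C. \<epsilon> < \<sigma> * g n x})"]) auto
  qed
  have "\<exists>rC. \<forall>k. P (rC k) \<and> (fst (rC k) < fst (rC (Suc k)) \<and> snd (rC (Suc k)) \<subseteq> snd (rC k))"
  proof (rule dependent_nat_choice)
    show "\<exists>rC. P rC" using next_set[of "B \<sigma> m"] nonnull by auto
    show "\<exists>y. P y \<and> (fst x < fst y \<and> snd y \<subseteq> snd x)" if "P x" for x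
      using next_set[of "snd x" "Suc (fst x)"] that unfolding P_def by (auto simp: Suc_le_eq)
  qed
  then obtain rC where rC: "\<And>k. P (rC k)" "\<And>k. fst (rC k) < fst (rC (Suc k))" "\<And>k. snd (rC (Suc k)) \<subseteq> snd (rC k)"
    by blast
  define r C where "r k = fst (rC k)" and "C k = snd (rC k)" for k
  have r: "strict_mono r" unfolding r_def using rC(2) by (simp add: strict_mono_Suc_iff)
  have C: "C k \<in> sets M" "C k \<notin> null_sets M" "\<And>x. x \<in> C k \<Longrightarrow> \<epsilon> < \<sigma> * g (r k) x" for k
    using rC(1)[of k] unfolding P_def r_def C_def by auto
  have Cdec: "C n \<subseteq> C k" if "k \<le> n" for k n
    using that rC(3) unfolding C_def by (rule lift_Suc_antimono_le[rotated])
  \<comment> \<open>The index \<open>j\<close> may depend on \<open>w\<close>: for two members the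
    smaller of the two nested sets serves both, which is why \<open>K\<close> is convex.\<close>
  define K where "K = {w\<in>Lp M p. \<exists>j. AE x in M. x \<in> C j \<longrightarrow> \<epsilon> \<le> \<sigma> * \<psi> (I w x)}"
  obtain b where b: "0 < b" "\<And>v. norm (\<psi> v) \<le> norm v * b"
    using bounded_linear.pos_bounded[OF \<psi>] by blast
  \<comment> \<open>With \<open>b\<close> bounding \<open>\<psi>\<close>, the value
    \<open>\<epsilon> / (2 * b)\<close> keeps \<open>\<psi> (I v x)\<close> within
    \<open>\<epsilon> / 2\<close>. A member of \<open>K\<close> that small would make its set
    \<open>C j\<close> null.\<close>
  obtain \<delta> where \<delta>: "0 < \<delta>" "\<And>v. v \<in> Lp M p \<Longrightarrow> Lp_norm M p v < \<delta> \<Longrightarrow> AE x in M. norm (I v x) \<le> \<epsilon> / (2 * b)"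
    using continuous_linear_Lp_Linf_AE_le[OF I, of "\<epsilon> / (2 * b)"] \<epsilon> b(1) by auto
  have K_ge: "\<delta> \<le> Lp_norm M p w" if w: "w \<in> K" for w
  proof (rule ccontr)
    assume "\<not> \<delta> \<le> Lp_norm M p w"
    then have "AE x in M. norm (I w x) \<le> \<epsilon> / (2 * b)" using \<delta>(2)[of w] w unfolding K_def by auto
    moreover obtain j where "AE x in M. x \<in> C j \<longrightarrow> \<epsilon> \<le> \<sigma> * \<psi> (I w x)" using w unfolding K_def by blast
    ultimately have "AE x in M. x \<notin> C j"
    proof eventually_elim
      case (elim x)
      have "norm (\<psi> (I w x)) \<le> \<epsilon> / 2"
        using b(2)[of "I w x"] mult_right_mono[OF elim(1), of b] b(1) by simp
      moreover have "\<sigma> * \<psi> (I w x) \<le> norm (\<psi> (I w x))"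
        using abs_ge_self[of "\<sigma> * \<psi> (I w x)"] \<sigma> by (simp add: abs_mult)
      ultimately show ?case using elim(2) \<epsilon> by linarith
    qed
    then show False using C(1,2)[of j] by (simp add: AE_iff_null_sets)
  qed
  have zK: "z (r j) \<in> K" for j
  proof -
    have "AE x in M. x \<in> C j \<longrightarrow> \<epsilon> \<le> \<sigma> * \<psi> (I (z (r j)) x)"
      using hAE by eventually_elim (use C(3)[of _ j] in \<open>auto simp: g_def less_imp_le\<close>)
    then show ?thesis using z unfolding K_def by blast
  qed
  have cvx: "fun_space.convex_in K"
    unfolding fun_space.convex_in_def
  proof (intro ballI allI impI)
    fix u w and t :: real assume uw: "u \<in> K" "w \<in> K" and t: "0 \<le> t \<and> t \<le> 1"
    then obtain i j where ij: "AE x in M. x \<in> C i \<longrightarrow> \<epsilon> \<le> \<sigma> * \<psi> (I u x)"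
      "AE x in M. x \<in> C j \<longrightarrow> \<epsilon> \<le> \<sigma> * \<psi> (I w x)" and L: "u \<in> Lp M p" "w \<in> Lp M p"
      unfolding K_def by blast
    define k where "k = max i j"
    have Ck: "C k \<subseteq> C i" "C k \<subseteq> C j" by (auto simp: k_def intro!: Cdec)
    note sL = Lp_scaleR(1)[OF p L(1), of "1 - t"] Lp_scaleR(1)[OF p L(2), of t]
    have lin: "AE x in M. I (\<lambda>y. (1 - t) *\<^sub>R u y + t *\<^sub>R w y) x = I (\<lambda>y. (1 - t) *\<^sub>R u y) x + I (\<lambda>y. t *\<^sub>R w y) x"
      "AE x in M. I (\<lambda>y. (1 - t) *\<^sub>R u y) x = (1 - t) *\<^sub>R I u x"
      "AE x in M. I (\<lambda>y. t *\<^sub>R w y) x = t *\<^sub>R I w x"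
      using continuous_linear_Lp_LinfD(2)[OF I sL] continuous_linear_Lp_LinfD(3)[OF I L(1)]
        continuous_linear_Lp_LinfD(3)[OF I L(2)] by simp_all
    have "AE x in M. x \<in> C k \<longrightarrow> \<epsilon> \<le> \<sigma> * \<psi> (I (\<lambda>y. (1 - t) *\<^sub>R u y + t *\<^sub>R w y) x)"
      using ij lin
    proof eventually_elim
      case (elim x)
      show ?case
      proof
        assume "x \<in> C k"
        then have "\<epsilon> \<le> \<sigma> * \<psi> (I u x)" "\<epsilon> \<le> \<sigma> * \<psi> (I w x)" using elim(1,2) Ck by auto
        then have "(1 - t) * \<epsilon> + t * \<epsilon> \<le> (1 - t) * (\<sigma> * \<psi> (I u x)) + t * (\<sigma> * \<psi> (I w x))"
          using t by (intro add_mono mult_left_mono) auto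
        also have "\<dots> = \<sigma> * \<psi> (I (\<lambda>y. (1 - t) *\<^sub>R u y + t *\<^sub>R w y) x)"
        proof -
          note lin\<psi> = bounded_linear.linear[OF \<psi>]
          show ?thesis
            by (simp only: elim(3-5) linear_add[OF lin\<psi>] linear_scale[OF lin\<psi>] real_scaleR_def)
              (simp only: algebra_simps)
        qed
        finally show "\<epsilon> \<le> \<sigma> * \<psi> (I (\<lambda>y. (1 - t) *\<^sub>R u y + t *\<^sub>R w y) x)" by (simp add: algebra_simps)
      qed
    qed
    then show "(\<lambda>x. (1 - t) *\<^sub>R u x) + (\<lambda>x. t *\<^sub>R w x) \<in> K"
      using Lp_add_norm_le(1)[OF p sL] unfolding K_def plus_fun_def by blast
  qed
  obtain \<phi> where \<phi>: "fun_space.linear_form_on (Lp M p) \<phi>"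
    "\<And>v. v \<in> Lp M p \<Longrightarrow> \<bar>\<phi> v\<bar> \<le> Lp_norm M p v" "\<And>k. k \<in> K \<Longrightarrow> \<delta> \<le> \<phi> k"
  proof (rule fun_space.separating_linear_form[where K=K and \<epsilon>=\<delta>, OF subspace_Lp[OF p] seminorm_on_Lp[OF p] _ cvx])
    show "K \<subseteq> Lp M p" by (auto simp: K_def)
    show "K \<noteq> {}" using zK by blast
    show "\<delta> \<le> Lp_norm M p k" if "k \<in> K" for k using K_ge[OF that] .
  qed blast
  have "(\<lambda>n. \<phi> (z n)) \<longlonglongrightarrow> 0" by (intro lim Lp_dualI[OF p] \<phi>)
  from LIMSEQ_subseq_LIMSEQ[OF this r] have "\<delta> \<le> 0"
    by (rule LIMSEQ_le_const) (use \<phi>(3)[OF zK] in auto)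
  then show False using \<delta>(1) by simp
qed

text \<open>Passing to the differences \<open>z n\<close> makes the target limit \<open>0\<close>,
  which norming functionals of the points of one fixed countable set can detect, whatever the value
  of \<open>I u x\<close>.\<close>

lemma Lp_weak_conv_imp_AE_weak_conv:
  fixes I :: "('a \<Rightarrow> 'e::banach) \<Rightarrow> ('a \<Rightarrow> 'e)"
  assumes uc: "uniformly_convex TYPE('e)" and p: "1 \<le> p" and I: "continuous_linear_Lp_Linf M p I"
    and un: "Lp_weak_conv M p un u"
  obtains C where "\<And>n. AE x in M. norm (I (un n) x) \<le> C" "AE x in M. weak_conv (\<lambda>n. I (un n) x) (I u x)"
proof -
  have L: "\<And>n. un n \<in> Lp M p" "u \<in> Lp M p" using un unfolding Lp_weak_conv_def by auto
  define z where "z n x = un n x - u x" for n x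
  have z: "z n \<in> Lp M p" for n unfolding z_def by (intro Lp_diff p L)
  have lim: "(\<lambda>n. \<phi> (z n)) \<longlonglongrightarrow> 0" if \<phi>: "\<phi> \<in> Lp_dual M p" for \<phi>
  proof -
    have "(\<lambda>n. \<phi> (un n) - \<phi> u) \<longlonglongrightarrow> 0"
      using un \<phi> unfolding Lp_weak_conv_def by (simp add: LIM_zero_iff)
    then show ?thesis
      unfolding z_def using Lp_dual_diff[OF p linear_form_on_Lp_dual[OF \<phi>] L(1) L(2)] by simp
  qed
  obtain C where C: "\<And>n. AE x in M. norm (I (z n) x) \<le> C"
    by (rule Lp_weakly_null_imp_AE_bounded[where z=z, OF p I z lim]) blast+
  have sum: "AE x in M. I (un n) x = I (z n) x + I u x" for n
  proof -
    have "AE x in M. I (\<lambda>y. z n y + u y) x = I (z n) x + I u x"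
      using continuous_linear_Lp_LinfD(2)[OF I z L(2)] .
    then show ?thesis by (simp add: z_def)
  qed
  note IL = continuous_linear_Lp_LinfD(1)[OF I]
  obtain D where D: "AE x in M. norm (I u x) \<le> D" using IL[OF L(2)] unfolding Linf_def by blast
  have bound: "AE x in M. norm (I (un n) x) \<le> C + D" for n
    using sum[of n] C[of n] D
    by eventually_elim (metis add_mono norm_triangle_ineq order_trans)
  have "\<exists>T. countable T \<and> (AE x in M. I (z n) x \<in> closure T)" for n
    using IL[OF z[of n]] strongly_measurable_AE_closure_countable unfolding Linf_def by blast
  then obtain T where T: "\<And>n. countable (T n)" "\<And>n. AE x in M. I (z n) x \<in> closure (T n)" by metis
  obtain S where S: "countable S" "(\<Union>n. T n) \<subseteq> S"
    "\<And>x y. x \<in> closure S \<Longrightarrow> y \<in> closure S \<Longrightarrow> (1/2) *\<^sub>R (x + y) \<in> closure S"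
    using countable_midpoint_closed_superset[of "\<Union>n. T n"] T(1) by auto
  have "\<exists>\<phi>. bounded_linear \<phi> \<and> (\<forall>v. \<bar>\<phi> v\<bar> \<le> norm v) \<and> \<phi> y = norm y" for y :: 'e
    using norming_bounded_linear[of y] by metis
  then obtain \<phi> where \<phi>: "\<And>y::'e. bounded_linear (\<phi> y)" "\<And>y v. \<bar>\<phi> y v\<bar> \<le> norm v" "\<And>y. \<phi> y y = norm y"
    by metis
  \<comment> \<open>All exceptional sets from here on are indexed by \<open>n\<close> or by the
    points of \<open>S\<close>, so their union is null.\<close>
  have "AE x in M. \<forall>n. I (z n) x \<in> closure (T n)" unfolding AE_all_countable using T(2) by blast
  moreover have "AE x in M. \<forall>n. norm (I (z n) x) \<le> C" unfolding AE_all_countable using C by blast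
  moreover have "AE x in M. \<forall>n. I (un n) x = I (z n) x + I u x" unfolding AE_all_countable using sum by blast
  moreover have "AE x in M. (\<lambda>n. \<phi> y (I (z n) x)) \<longlonglongrightarrow> 0" for y
    by (rule Lp_weakly_null_imp_AE_functional_null[where z=z and \<psi>="\<phi> y", OF p I z]) (use lim \<phi> in auto)
  then have "AE x in M. \<forall>y\<in>S. (\<lambda>n. \<phi> y (I (z n) x)) \<longlonglongrightarrow> 0"
    using S(1) by (simp add: AE_ball_countable)
  ultimately have "AE x in M. weak_conv (\<lambda>n. I (un n) x) (I u x)"
  proof eventually_elim
    case (elim x)
    have "I (z n) x \<in> closure S" for n
      using elim(1) closure_mono[of "T n" S] S(2) by blast
    then have "weak_conv (\<lambda>n. I (z n) x) 0"
      using elim S(3) \<phi> by (intro weak_conv_zeroI[OF uc, of _ C S \<phi>]) auto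
    show ?case
      unfolding weak_conv_def
    proof (intro allI impI)
      fix \<psi> :: "'e \<Rightarrow> real" assume \<psi>: "bounded_linear \<psi>"
      note lin = bounded_linear.linear[OF \<psi>]
      have "(\<lambda>n. \<psi> (I (z n) x)) \<longlonglongrightarrow> 0"
        using \<open>weak_conv (\<lambda>n. I (z n) x) 0\<close> \<psi> linear_0[OF lin] unfolding weak_conv_def by metis
      then have "(\<lambda>n. \<psi> (I (z n) x) + \<psi> (I u x)) \<longlonglongrightarrow> 0 + \<psi> (I u x)" by (intro tendsto_intros)
      then show "(\<lambda>n. \<psi> (I (un n) x)) \<longlonglongrightarrow> \<psi> (I u x)" using elim(3) by (simp add: linear_add[OF lin])
    qed
  qed
  then show thesis using that[OF bound] by blast
qed

subsection \<open>The substitution operator\<close>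

lemma locally_bounded_on_imp_bounded:
  assumes "locally_bounded_on {0..} \<psi>"
  obtains B where "0 \<le> B" "\<And>t. 0 \<le> t \<Longrightarrow> t \<le> C \<Longrightarrow> \<psi> t \<le> B"
proof -
  obtain U where U: "\<And>t. 0 \<le> t \<Longrightarrow> open (U t)" "\<And>t. 0 \<le> t \<Longrightarrow> t \<in> U t"
    "\<And>t. 0 \<le> t \<Longrightarrow> bounded (\<psi> ` (U t \<inter> {0..}))"
    using assms unfolding locally_bounded_on_def by (metis atLeast_iff)
  obtain T where T: "T \<subseteq> {0..C}" "finite T" "{0..C} \<subseteq> (\<Union>t\<in>T. U t)"
    by (rule compactE_image[OF compact_Icc, of "{0..C}" U 0 C]) (use U in auto)
  have "bounded (\<Union>t\<in>T. \<psi> ` (U t \<inter> {0..}))"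
    using T U(3) by (intro bounded_UN) auto
  then obtain B where B: "\<And>y. y \<in> (\<Union>t\<in>T. \<psi> ` (U t \<inter> {0..})) \<Longrightarrow> norm y \<le> B"
    unfolding bounded_iff by blast
  have "\<psi> t \<le> max B 0" if "0 \<le> t" "t \<le> C" for t
  proof -
    have "\<psi> t \<in> (\<Union>t\<in>T. \<psi> ` (U t \<inter> {0..}))" using T(3) that by fastforce
    then show ?thesis using B[of "\<psi> t"] by simp
  qed
  then show thesis using that[of "max B 0"] by simp
qed

text \<open>The hypothesis on \<open>f\<close> controls one second argument at a time; a simple
  function has finitely many values, so the composition is a finite sum of such pieces cut out by
  indicators.\<close>

lemma strongly_measurable_substitution_simple:
  fixes f :: "'a \<Rightarrow> 'e::real_normed_vector \<Rightarrow> 'e"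
  assumes f: "weak_caratheodory M f" and s: "simple_function M s"
  shows "strongly_measurable M (\<lambda>x. f x (s x))"
proof -
  have fin: "finite (s ` space M)" using s by (simp add: simple_function_def)
  have one: "strongly_measurable M (\<lambda>x. indicat_real (s -` {c} \<inter> space M) x *\<^sub>R f x c)" if "c \<in> s ` space M" for c
  proof (rule strongly_measurable_compose2[where h=scaleR])
    have "s -` {c} \<inter> space M \<in> sets M" using simple_functionD(2)[OF s] .
    then show "strongly_measurable M (indicat_real (s -` {c} \<inter> space M))"
      by (intro simple_limit_imp_strongly_measurable simple_limit_real) simp
    show "strongly_measurable M (\<lambda>x. f x c)" using f unfolding weak_caratheodory_def by blast
  qed (rule tendsto_scaleR)
  have "strongly_measurable M (\<lambda>x. \<Sum>c\<in>T. indicat_real (s -` {c} \<inter> space M) x *\<^sub>R f x c)"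
    if "finite T" "T \<subseteq> s ` space M" for T
    using that
  proof (induction T rule: finite_induct)
    case empty
    then show ?case using simple_limit_imp_strongly_measurable[OF simple_limit_const] by simp
  next
    case (insert c T)
    then show ?case
      unfolding sum.insert[OF insert(1,2)] by (intro strongly_measurable_add one) auto
  qed
  from this[OF fin subset_refl] show ?thesis
  proof (rule strongly_measurable_cong_AE)
    show "AE x in M. (\<Sum>c\<in>s ` space M. indicat_real (s -` {c} \<inter> space M) x *\<^sub>R f x c) = f x (s x)"
    proof (rule AE_I2)
      fix x assume x: "x \<in> space M"
      have "(\<Sum>c\<in>s ` space M. indicat_real (s -` {c} \<inter> space M) x *\<^sub>R f x c) =
          (\<Sum>c\<in>s ` space M. if c = s x then f x c else 0)"
        using x by (intro sum.cong) (auto simp: indicator_def)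
      then show "(\<Sum>c\<in>s ` space M. indicat_real (s -` {c} \<inter> space M) x *\<^sub>R f x c) = f x (s x)"
        using fin x by simp
    qed
  qed
qed

theorem lemma7p11:
  fixes M :: "'a::t2_space measure"
    and p q :: real
    and I :: "('a \<Rightarrow> 'e::banach) \<Rightarrow> ('a \<Rightarrow> 'e)"
    and f :: "'a \<Rightarrow> 'e \<Rightarrow> 'e"
    and A :: "'a \<Rightarrow> real"
    and \<psi> :: "real \<Rightarrow> real"
  assumes "uniformly_convex TYPE('e)"
    and "radon_measure M"
    and "1 \<le> p" and "1 \<le> q"
    and "continuous_linear_Lp_Linf M p I"
    and "weak_caratheodory M f"
    and "A \<in> Lp M q"
    and "\<forall>t\<ge>0. 0 \<le> \<psi> t"
    and "locally_bounded_on {0..} \<psi>"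
    and "AE x in M. \<forall>u. norm (f x u) \<le> A x * \<psi> (norm u)"
    and "q > 1 \<or> (p = 1 \<and> q = 1)"
  shows "class_map M (Lp M p) (Lp M q) (substitution_operator f \<circ> I) \<and>
         Lp_seq_weakly_continuous M p q (substitution_operator f \<circ> I)"
proof -
  note uc = assms(1) and p = assms(3) and q = assms(4) and I = assms(5) and f = assms(6) and A = assms(7)
  have "strongly_measurable M A" using A unfolding Lp_def by blast
  then obtain A' where A': "simple_limit M A'" "AE x in M. A x = A' x"
    by (rule strongly_measurable_obtain_simple_limit)
  have A'L: "A' \<in> Lp M q" using Lp_cong_AE[OF A A'(2)] .
  \<comment> \<open>Applied twice: to simple approximants of one bounded function, where it yields
    membership in \<open>Lp M q\<close>, and to the images of a weakly convergent sequence.\<close>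
  have dominated: "Lp_weak_conv M q (\<lambda>n x. f x (w n x)) (\<lambda>x. f x (v x))"
    if m: "\<And>n. strongly_measurable M (\<lambda>x. f x (w n x))"
      and w: "\<And>n. AE x in M. norm (w n x) \<le> C" and lim: "AE x in M. weak_conv (\<lambda>n. w n x) (v x)" for w v C
  proof -
    obtain B where B: "0 \<le> B" "\<And>t. 0 \<le> t \<Longrightarrow> t \<le> C \<Longrightarrow> \<psi> t \<le> B"
      using locally_bounded_on_imp_bounded[OF assms(9)] by blast
    show ?thesis
    \<comment> \<open>\<open>A\<close> carries no sign and need not be Borel measurable, so the
      majorant uses the absolute value of its representative \<open>A'\<close>.\<close>
    proof (rule dominated_weak_conv_Lp[OF uc q _ _ _ m, of "\<lambda>x. norm (B *\<^sub>R A' x)"])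
      show "(\<lambda>x. norm (B *\<^sub>R A' x)) \<in> borel_measurable M"
        using simple_limit_borel_measurable[OF A'(1)] by measurable
      show "(\<integral>\<^sup>+x. ennreal (norm (B *\<^sub>R A' x) powr q) \<partial>M) < \<infinity>"
        using Lp_scaleR(1)[OF q A'L, of B] unfolding Lp_def by blast
      show "AE x in M. norm (f x (w n x)) \<le> norm (B *\<^sub>R A' x)" for n
        using assms(10) w[of n] A'(2)
      proof eventually_elim
        case (elim x)
        have "norm (f x (w n x)) \<le> A x * \<psi> (norm (w n x))" using elim by blast
        also have "\<dots> \<le> \<bar>A x\<bar> * \<psi> (norm (w n x))"
          using assms(8) by (intro mult_right_mono) auto
        also have "\<dots> \<le> \<bar>A x\<bar> * B" using B elim(2) by (intro mult_left_mono) auto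
        finally show ?case using elim(3) B(1) by (simp add: abs_mult mult.commute)
      qed
      have "AE x in M. seq_weakly_continuous (f x)" using f unfolding weak_caratheodory_def by blast
      then show "AE x in M. weak_conv (\<lambda>n. f x (w n x)) (f x (v x))"
        using lim by eventually_elim (auto simp: seq_weakly_continuous_def)
    qed simp
  qed
  \<comment> \<open>Since \<open>f x\<close> is only weakly continuous, simple approximants
    converging in norm to \<open>w x\<close> have images that converge merely weakly. The dominated
    result still makes the limit strongly measurable and puts it into \<open>Lp M q\<close>.\<close>
  have subst: "(\<lambda>x. f x (w x)) \<in> Lp M q" if w: "w \<in> Linf M" for w
  proof -
    obtain s where s: "\<And>n::nat. simple_function M (s n)" "AE x in M. (\<lambda>n. s n x) \<longlonglongrightarrow> w x"
      using w unfolding Linf_def strongly_measurable_def by blast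
    obtain C where C: "AE x in M. norm (w x) \<le> C" using w unfolding Linf_def by blast
    \<comment> \<open>Truncation supplies a common bound for all \<open>n\<close>. The margin
      \<open>1\<close> above the essential bound makes it inactive eventually at almost every
      point.\<close>
    define t where "t n x = (if norm (s n x) \<le> \<bar>C\<bar> + 1 then s n x else 0)" for n x
    have "simple_function M (t n)" for n
      unfolding t_def by (rule simple_function_compose1[OF s(1)])
    then have "\<And>n. strongly_measurable M (\<lambda>x. f x (t n x))"
      by (rule strongly_measurable_substitution_simple[OF f])
    moreover have "AE x in M. norm (t n x) \<le> \<bar>C\<bar> + 1" for n by (rule AE_I2) (simp add: t_def)
    moreover have "AE x in M. weak_conv (\<lambda>n. t n x) (w x)"
      using s(2) C
    proof eventually_elim
      case (elim x)
      have "\<forall>\<^sub>F n in sequentially. norm (s n x) < \<bar>C\<bar> + 1"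
        using elim by (intro order_tendstoD(2)[OF tendsto_norm[OF elim(1)]]) auto
      then have "\<forall>\<^sub>F n in sequentially. s n x = t n x"
        by eventually_elim (simp add: t_def)
      then have "(\<lambda>n. t n x) \<longlonglongrightarrow> w x" using elim(1) by (rule Lim_transform_eventually[rotated])
      then show ?case by (rule tendsto_imp_weak_conv)
    qed
    ultimately have "Lp_weak_conv M q (\<lambda>n x. f x (t n x)) (\<lambda>x. f x (w x))" by (rule dominated)
    then show ?thesis unfolding Lp_weak_conv_def by blast
  qed
  note IL = continuous_linear_Lp_LinfD(1)[OF I]
  have "class_map M (Lp M p) (Lp M q) (substitution_operator f \<circ> I)"
    unfolding class_map_def
  proof (intro conjI ballI impI)
    show "(substitution_operator f \<circ> I) u \<in> Lp M q" if "u \<in> Lp M p" for u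
      using subst[OF IL[OF that]] by (simp add: substitution_operator_def)
    fix u v :: "'a \<Rightarrow> 'e" assume "u \<in> Lp M p" "v \<in> Lp M p" "AE x in M. u x = v x"
    then have "AE x in M. I u x = I v x" by (rule continuous_linear_Lp_LinfD(4)[OF I])
    then show "AE x in M. (substitution_operator f \<circ> I) u x = (substitution_operator f \<circ> I) v x"
      by eventually_elim (simp add: substitution_operator_def)
  qed
  moreover have "Lp_seq_weakly_continuous M p q (substitution_operator f \<circ> I)"
    unfolding Lp_seq_weakly_continuous_def
  proof (intro allI impI)
    fix un and u :: "'a \<Rightarrow> 'e" assume un: "Lp_weak_conv M p un u"
    then obtain C where C: "\<And>n. AE x in M. norm (I (un n) x) \<le> C"
      "AE x in M. weak_conv (\<lambda>n. I (un n) x) (I u x)"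
      using Lp_weak_conv_imp_AE_weak_conv[OF uc p I] by blast
    have "strongly_measurable M (\<lambda>x. f x (I (un n) x))" for n
      using subst[OF IL] un unfolding Lp_weak_conv_def Lp_def by blast
    then show "Lp_weak_conv M q (\<lambda>n. (substitution_operator f \<circ> I) (un n)) ((substitution_operator f \<circ> I) u)"
      using dominated[OF _ C] by (simp add: substitution_operator_def)
  qed
  ultimately show ?thesis by blast
qed

end
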